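(* Let $G$ be a ribbon graph with a proper ribbon $e$, and let $G+\sum_{i=1}^{n}e_i$ be the ribbon graph obtained from $G$ by adding $n$ ribbons $e_1,e_2,\dots,e_n$ parallel to $e$. Write $Q_H(z)$ for the restricted-orientable partial-$\times$ polynomial of a ribbon graph $H$. (1) Suppose $Q_G(z)$ has only one term, and let $f^0(G^{\times|_A})$ denote the number of faces of $G^{\times|_A}$ for a set $A\subseteq E(G)$ with $e\in A$ and $G^{\times|_A}$ orientable. If $$n\ge\begin{cases}4, & \text{if } f^0_{\max}(G+e_1)=f^0(G^{\times|_A})+1,\\ 3, & \text{if } f^0_{\max}(G+e_1)=f^0(G^{\times|_A})-1,\end{cases}$$ then $Q_{G+\sum_{i=1}^{n}e_i}(z)$ is not even-interpolating. (2) Suppose $Q_G(z)$ has more than one term. If $$n\ge \min\{\,f^0_{\max}(G+e_1)-f^1_{\min}(G)+4,\ f^0_{\max}(G)-f^1_{\min}(G)+4\,\},$$ then $Q_{G+\sum_{i=1}^{n}e_i}(z)$ is not even-interpolating.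
   Context: A ribbon graph $G$ is a (possibly non-orientable) surface with boundary presented as a union of vertex discs and edge ribbons; $E(G)$ is its set of edges (ribbons), and $v(G)$, $e(G)$, $f(G)$, $c(G)$ are its numbers of vertices, edges, faces (boundary components) and connected components. The Euler genus is $\gamma(G)=2c(G)-v(G)+e(G)-f(G)$. For $A\subseteq E(G)$, the partial Petrial $G^{\times|_A}$ is the ribbon graph obtained from $G$ by adding a half-twist to each ribbon in $A$. The restricted-orientable partial-$\times$ polynomial of $G$ is $Q_G(z)=\sum_{A} z^{\gamma(G^{\times|_A})}$, where the sum is over all $A\subseteq E(G)$ such that $G^{\times|_A}$ is orientable. A proper ribbon is a ribbon with two different end vertices. Adding $n$ ribbons $e_1,\dots,e_n$ parallel to $e$ means adding new ribbons with the same end vertices as $e$, placed consecutively next to $e$ at both ends, so that in the sequence $e,e_1,\dots,e_n$ each two consecutive ribbons bound a face of length two (a bigon); $G+e_1$ is the case $n=1$. For a ribbon graph $H$ containing the fixed ribbon $e$ (here $H=G$ or $H=G+e_1$), $f^0_{\max}(H)$ is the maximum of $f(H^{\times|_B})$ over all $B\subseteq E(H)$ with $e\in B$ and $H^{\times|_B}$ orientable, and $f^1_{\min}(H)$ is the minimum of $f(H^{\times|_B})$ over all $B\subseteq E(H)$ with $e\notin B$ and $H^{\times|_B}$ orientable. (When $Q_G(z)$ has only one term, all orientable $G^{\times|_A}$ have the same number of faces, so $f^0(G^{\times|_A})$ does not depend on the choice of $A$.) The support of $f(z)=\sum_{i} a_i z^i$ is $\{i : a_i\neq 0\}$; a polynomial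 is even-interpolating if its support is the set of all even natural numbers in some integer interval $[m,m']$. *)

theory Defs
  imports "HOL-Computational_Algebra.Polynomial"
begin

text \<open>
  Ribbon graphs are encoded as signed rotation systems.  A ribbon \<open>x\<close> has the two ends
  \<open>(x, False)\<close> and \<open>(x, True)\<close>.  Each vertex disc carries a reference orientation, and \<open>rot G v\<close>
  lists, up to cyclic rotation, the ribbon ends met along the boundary of the disc \<open>v\<close> in that
  direction; a disc without ribbons has the empty list.  The set \<open>twisted G\<close> consists of the ribbons
  along which the reference orientations of the discs at the two ends do not agree
  (the ribbons with a half-twist).
\<close>

record ('v, 'e) pre_ribbon_graph =
  verts :: "'v set"
  edges :: "'e set"
  rot :: "'v \<Rightarrow> ('e \<times> bool) list"
  twisted :: "'e set"

locale ribbon_graph =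
  fixes G :: "('v, 'e) pre_ribbon_graph" (structure)
  assumes finite_verts: "finite (verts G)"
    and finite_edges: "finite (edges G)"
    and twisted_subset: "twisted G \<subseteq> edges G"
    and distinct_rot: "v \<in> verts G \<Longrightarrow> distinct (rot G v)"
    and disjoint_rot: "v \<in> verts G \<Longrightarrow> w \<in> verts G \<Longrightarrow> v \<noteq> w \<Longrightarrow> set (rot G v) \<inter> set (rot G w) = {}"
    and Union_rot: "(\<Union>v\<in>verts G. set (rot G v)) = edges G \<times> UNIV"

definition end_vertex :: "('v, 'e) pre_ribbon_graph \<Rightarrow> 'e \<times> bool \<Rightarrow> 'v" where
  "end_vertex G d = (THE v. v \<in> verts G \<and> d \<in> set (rot G v))"

definition proper_ribbon :: "('v, 'e) pre_ribbon_graph \<Rightarrow> 'e \<Rightarrow> bool" where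
  "proper_ribbon G x \<longleftrightarrow> x \<in> edges G \<and> end_vertex G (x, False) \<noteq> end_vertex G (x, True)"

definition num_classes :: "'a set \<Rightarrow> ('a \<times> 'a) set \<Rightarrow> nat" where
  "num_classes X r = card (X // ((r \<union> r\<inverse>)\<^sup>*))"

definition num_components :: "('v, 'e) pre_ribbon_graph \<Rightarrow> nat" where
  "num_components G = num_classes (verts G)
     {(end_vertex G (x, False), end_vertex G (x, True)) | x. x \<in> edges G}"

text \<open>
  A ribbon end \<open>d\<close> is attached to its disc along an arc, whose two end points are the corners
  \<open>(d, False)\<close> (met first in the reference direction) and \<open>(d, True)\<close> (met second).  The boundary
  of the surface consists of the arcs of disc boundary between consecutive ribbon ends, of the
  two free sides of each ribbon, and of the full boundary circles of the discs without ribbons.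
\<close>

definition disc_arcs :: "('v, 'e) pre_ribbon_graph \<Rightarrow> ((('e \<times> bool) \<times> bool) \<times> (('e \<times> bool) \<times> bool)) set"
  where
  "disc_arcs G = {((rot G v ! i, True), (rot G v ! (Suc i mod length (rot G v)), False)) | v i.
     v \<in> verts G \<and> i < length (rot G v)}"

definition ribbon_sides :: "('v, 'e) pre_ribbon_graph \<Rightarrow> ((('e \<times> bool) \<times> bool) \<times> (('e \<times> bool) \<times> bool)) set"
  where
  "ribbon_sides G = {(((x, False), s), ((x, True), if x \<in> twisted G then s else \<not> s)) | x s.
     x \<in> edges G}"

definition num_faces :: "('v, 'e) pre_ribbon_graph \<Rightarrow> nat" where
  "num_faces G = num_classes ((edges G \<times> UNIV) \<times> UNIV) (disc_arcs G \<union> ribbon_sides G)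
     + card {v \<in> verts G. rot G v = []}"

definition euler_genus :: "('v, 'e) pre_ribbon_graph \<Rightarrow> int" where
  "euler_genus G = 2 * int (num_components G) - int (card (verts G)) + int (card (edges G))
     - int (num_faces G)"

text \<open>
  The surface is orientable iff the discs can be oriented so that the orientations of the discs at
  both ends of each ribbon agree along that ribbon; \<open>flip v\<close> states that \<open>v\<close> receives the opposite
  of its reference orientation.
\<close>

definition orientable :: "('v, 'e) pre_ribbon_graph \<Rightarrow> bool" where
  "orientable G \<longleftrightarrow> (\<exists>flip :: 'v \<Rightarrow> bool. \<forall>x\<in>edges G.
     (flip (end_vertex G (x, False)) = flip (end_vertex G (x, True))) = (x \<notin> twisted G))"

definition partial_petrial :: "('v, 'e) pre_ribbon_graph \<Rightarrow> 'e set \<Rightarrow> ('v, 'e) pre_ribbon_graph" where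
  "partial_petrial G A = G\<lparr>twisted := (twisted G - A) \<union> (A - twisted G)\<rparr>"

definition orientable_sets :: "('v, 'e) pre_ribbon_graph \<Rightarrow> 'e set set" where
  "orientable_sets G = {A. A \<subseteq> edges G \<and> orientable (partial_petrial G A)}"

text \<open>The Euler genus of a ribbon graph is never negative, so \<open>nat\<close> only converts the type.\<close>

definition petrial_poly :: "('v, 'e) pre_ribbon_graph \<Rightarrow> int poly" where
  "petrial_poly G = (\<Sum>A\<in>orientable_sets G. monom 1 (nat (euler_genus (partial_petrial G A))))"

definition poly_support :: "'a::zero poly \<Rightarrow> nat set" where
  "poly_support p = {i. coeff p i \<noteq> 0}"

definition even_interpolating :: "'a::zero poly \<Rightarrow> bool" where
  "even_interpolating p \<longleftrightarrow>
     (\<exists>m m' :: int. poly_support p = {i. even i \<and> m \<le> int i \<and> int i \<le> m'})"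

text \<open>
  New ribbons \<open>es\<close> parallel to \<open>e\<close>: at the end \<open>(e, False)\<close> they follow \<open>e\<close> in the given order.
  If \<open>e\<close> is untwisted, they precede \<open>e\<close> in reverse order at the end \<open>(e, True)\<close>; if \<open>e\<close> is twisted,
  so are the new ribbons and they follow \<open>e\<close> at that end too.  In both cases any two consecutive
  ribbons of \<open>e # es\<close> bound a bigon.
\<close>

definition insert_parallel_ends ::
  "('v, 'e) pre_ribbon_graph \<Rightarrow> 'e \<Rightarrow> 'e list \<Rightarrow> 'e \<times> bool \<Rightarrow> ('e \<times> bool) list" where
  "insert_parallel_ends G e es d =
     (if d = (e, False) then (e, False) # map (\<lambda>x. (x, False)) es
      else if d = (e, True) then
        (if e \<in> twisted G then (e, True) # map (\<lambda>x. (x, True)) es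
         else map (\<lambda>x. (x, True)) (rev es) @ [(e, True)])
      else [d])"

definition add_parallel :: "('v, 'e) pre_ribbon_graph \<Rightarrow> 'e \<Rightarrow> 'e list \<Rightarrow> ('v, 'e) pre_ribbon_graph" where
  "add_parallel G e es =
     \<lparr>verts = verts G,
      edges = edges G \<union> set es,
      rot = (\<lambda>v. concat (map (insert_parallel_ends G e es) (rot G v))),
      twisted = (if e \<in> twisted G then twisted G \<union> set es else twisted G)\<rparr>"

definition f0_max :: "('v, 'e) pre_ribbon_graph \<Rightarrow> 'e \<Rightarrow> nat" where
  "f0_max H e = Max ((\<lambda>B. num_faces (partial_petrial H B)) ` {B \<in> orientable_sets H. e \<in> B})"

definition f1_min :: "('v, 'e) pre_ribbon_graph \<Rightarrow> 'e \<Rightarrow> nat" where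
  "f1_min H e = Min ((\<lambda>B. num_faces (partial_petrial H B)) ` {B \<in> orientable_sets H. e \<notin> B})"

end

theory Submission
  imports Defs
begin

text \<open>
  Ribbons parallel to \<open>e\<close> share the ends and the twist of \<open>e\<close>. The twisted ribbons of an orientable ribbon graph
  form an edge cut, so a partial Petrial can only be orientable if all of the parallel ribbons are
  toggled together with \<open>e\<close> or none of them is. Hence the orientable partial Petrials of
  \<open>G\<close> and of \<open>G\<close> with \<open>n\<close> added ribbons correspond to each other
  (\<open>orientable_sets_add_parallel\<close>), and it remains to compare their genera.

  If \<open>e\<close> is not toggled, each new ribbon cuts off one more bigon, and the Euler genus does not
  change. If \<open>e\<close> is toggled, each boundary component that enters the bundle of parallel ribbons
  zigzags through all of it, and two further ribbons restore the way in which the ends of these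
  paths are matched. Thus the number of faces has period two in \<open>n\<close>, and for odd \<open>n\<close> it is the
  number of faces that remain when \<open>e\<close> is deleted. So one part of the support of the polynomial is
  independent of \<open>n\<close>, whereas the other part moves up by two whenever two ribbons are added. The
  bounds on \<open>n\<close> make every element of the second part exceed the maximum \<open>M\<close> of the first part by
  at least four; then \<open>M + 2\<close> lies between two elements of the support but does not belong to it.

  When \<open>Q\<^sub>G\<close> has several terms, the first expression under the minimum is the bound that is right for
  odd \<open>n\<close>, the second one that for even \<open>n\<close>. The two differ by at most one, because deleting a
  ribbon changes the number of faces by at most one. If the polynomial were even-interpolating,
  all of its exponents would be even, and this forces the bound that belongs to the parity
  of \<open>n\<close> to have the same parity as \<open>n\<close>. Therefore \<open>n\<close> satisfies this bound as soon as it satisfies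
  the other one.

  Exponents are natural numbers, so genera can only be read off from them once the Euler genus is
  known to be nonnegative. This holds since building the graph up ribbon by ribbon creates at most
  one face per ribbon, and a ribbon that joins two components removes a face
  (\<open>spanning_faces_bound\<close>).
\<close>

section \<open>Classes of the equivalence relation generated by links\<close>

text \<open>
  Boundary components are traversed in either direction, so links are used symmetrically.
\<close>

definition linked :: "('a \<times> 'a) set \<Rightarrow> ('a \<times> 'a) set" where
  "linked r = (r \<union> r\<inverse>)\<^sup>*"

lemma num_classes_linked: "num_classes X r = card (X // linked r)"
  by (simp add: num_classes_def linked_def)

lemma linked_refl [simp]: "(a, a) \<in> linked r"
  by (simp add: linked_def)

lemma linked_sym: "(a, b) \<in> linked r \<Longrightarrow> (b, a) \<in> linked r"
  unfolding linked_def by (metis converse_Un converse_converse rtrancl_converseI sup_commute)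

lemma linked_trans: "(a, b) \<in> linked r \<Longrightarrow> (b, c) \<in> linked r \<Longrightarrow> (a, c) \<in> linked r"
  unfolding linked_def by (rule rtrancl_trans)

lemma linkedI: "(a, b) \<in> r \<Longrightarrow> (a, b) \<in> linked r"
  by (auto simp: linked_def)

lemma linkedI': "(b, a) \<in> r \<Longrightarrow> (a, b) \<in> linked r"
  by (auto simp: linked_def)

lemma linked_map:
  assumes "\<And>a b. (a, b) \<in> r \<Longrightarrow> (f a, f b) \<in> linked r'"
    and "(a, b) \<in> linked r"
  shows "(f a, f b) \<in> linked r'"
  using assms(2) unfolding linked_def[of r]
proof (induction rule: rtrancl_induct)
  case (step y z)
  from step.hyps(2) have "(f y, f z) \<in> linked r'"
  proof
    assume "(y, z) \<in> r"
    then show ?thesis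
      by (rule assms(1))
  next
    assume "(y, z) \<in> r\<inverse>"
    then have "(z, y) \<in> r"
      by simp
    then show ?thesis
      by (intro linked_sym[OF assms(1)])
  qed
  with step.IH show ?case
    by (rule linked_trans)
qed simp

lemma linked_closed:
  assumes "\<And>a b. (a, b) \<in> r \<Longrightarrow> a \<in> B \<longleftrightarrow> b \<in> B" and "(a, b) \<in> linked r"
  shows "a \<in> B \<longleftrightarrow> b \<in> B"
proof -
  have "(a \<in> B, b \<in> B) \<in> linked {}"
  proof (rule linked_map[of r "\<lambda>c. c \<in> B", OF _ assms(2)])
    show "(a \<in> B, b \<in> B) \<in> linked {}" if "(a, b) \<in> r" for a b
      by (simp only: assms(1)[OF that] linked_refl)
  qed
  then show ?thesis
    by (simp add: linked_def)
qed

lemma linked_mono: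
  assumes "r \<subseteq> linked r'"
  shows "linked r \<subseteq> linked r'"
proof (rule subrelI)
  fix a b assume "(a, b) \<in> linked r"
  then show "(a, b) \<in> linked r'"
    by (rule linked_map[of r "\<lambda>x. x" r', rotated]) (use assms in blast)
qed

lemma linked_Image_eq: "linked r `` {a} = linked r `` {b} \<longleftrightarrow> (a, b) \<in> linked r"
proof
  assume "linked r `` {a} = linked r `` {b}"
  then have "b \<in> linked r `` {a}"
    by simp
  then show "(a, b) \<in> linked r"
    by simp
next
  assume ab: "(a, b) \<in> linked r"
  show "linked r `` {a} = linked r `` {b}"
    using linked_trans[OF ab] linked_trans[OF linked_sym[OF ab]] by blast
qed

text \<open>
  The two maps induce mutually inverse maps between the classes. As they only have to be inverse
  up to linkage, intermediate points may be inserted into a boundary component or removed from it.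
\<close>

lemma num_classes_retract:
  assumes "\<And>a b. (a, b) \<in> r \<Longrightarrow> (f a, f b) \<in> linked r'"
    and "\<And>a b. (a, b) \<in> r' \<Longrightarrow> (g a, g b) \<in> linked r"
    and "\<And>x. x \<in> X \<Longrightarrow> f x \<in> Y" and "\<And>y. y \<in> Y \<Longrightarrow> g y \<in> X"
    and "\<And>x. x \<in> X \<Longrightarrow> (g (f x), x) \<in> linked r"
    and "\<And>y. y \<in> Y \<Longrightarrow> (f (g y), y) \<in> linked r'"
  shows "num_classes X r = num_classes Y r'"
proof -
  have f: "(f a, f b) \<in> linked r'" if "(a, b) \<in> linked r" for a b
    by (rule linked_map[of r f r', OF _ that]) (rule assms(1))
  have g: "(g a, g b) \<in> linked r" if "(a, b) \<in> linked r'" for a b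
    by (rule linked_map[of r' g r, OF _ that]) (rule assms(2))
  let ?h = "\<lambda>C. linked r' `` (f ` C)"
  have h: "?h (linked r `` {x}) = linked r' `` {f x}" for x
  proof
    show "?h (linked r `` {x}) \<subseteq> linked r' `` {f x}"
      using f linked_trans[of "f x" _ r'] by blast
    show "linked r' `` {f x} \<subseteq> ?h (linked r `` {x})"
      by (auto intro: linked_refl)
  qed
  have "bij_betw ?h (X // linked r) (Y // linked r')"
  proof (rule bij_betwI')
    fix C D assume "C \<in> X // linked r" "D \<in> X // linked r"
    then obtain x y where xy: "x \<in> X" "y \<in> X" "C = linked r `` {x}" "D = linked r `` {y}"
      by (auto simp: quotient_def)
    have "(x, y) \<in> linked r" if "(f x, f y) \<in> linked r'"
      by (rule linked_trans[OF linked_trans[OF linked_sym[OF assms(5)[OF xy(1)]] g[OF that]]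
            assms(5)[OF xy(2)]])
    then show "(?h C = ?h D) = (C = D)"
      using f unfolding xy(3,4) h linked_Image_eq by blast
  next
    fix C assume "C \<in> X // linked r"
    then show "?h C \<in> Y // linked r'"
      by (auto simp: quotient_def h simp del: Image_singleton_iff intro!: assms(3))
  next
    fix D assume "D \<in> Y // linked r'"
    then obtain y where y: "y \<in> Y" "D = linked r' `` {y}"
      by (auto simp: quotient_def)
    have "D = ?h (linked r `` {g y})"
      using linked_sym[OF assms(6)[OF y(1)]] unfolding h y(2) linked_Image_eq .
    then show "\<exists>C\<in>X // linked r. D = ?h C"
      using assms(4)[OF y(1)] by (auto intro: quotientI)
  qed
  then show ?thesis
    by (simp add: num_classes_linked bij_betw_same_card)
qed

lemma num_classes_cong: "linked r = linked r' \<Longrightarrow> num_classes X r = num_classes X r'"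
  by (simp add: num_classes_linked)

lemma linked_insert:
  "(x, y) \<in> linked (insert (a, b) r) \<longleftrightarrow>
     (x, y) \<in> linked r \<or> (x, a) \<in> linked r \<and> (b, y) \<in> linked r
     \<or> (x, b) \<in> linked r \<and> (a, y) \<in> linked r" (is "?L \<longleftrightarrow> ?R x y")
proof
  assume ?L
  then show "?R x y"
    unfolding linked_def[of "insert (a, b) r"]
  proof (induction rule: rtrancl_induct)
    case (step y z)
    then consider "(y, z) \<in> linked r" | "y = a" "z = b" | "y = b" "z = a"
      by (auto intro: linkedI linkedI')
    then show ?case
    proof cases
      case 1
      then show ?thesis
        using step.IH linked_trans[OF _ 1] by blast
    next
      case 2
      then show ?thesis
        using step.IH linked_trans[of x b r a] linked_refl[of b r] by blast
    next
      case 3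
      then show ?thesis
        using step.IH linked_trans[of x a r b] linked_refl[of a r] by blast
    qed
  qed simp
next
  have "r \<subseteq> linked (insert (a, b) r)"
    by (auto intro: linkedI)
  then have mono: "(p, q) \<in> linked (insert (a, b) r)" if "(p, q) \<in> linked r" for p q
    using linked_mono that by blast
  have ab: "(a, b) \<in> linked (insert (a, b) r)"
    by (auto intro: linkedI)
  assume "?R x y"
  then consider "(x, y) \<in> linked r" | "(x, a) \<in> linked r" "(b, y) \<in> linked r"
    | "(x, b) \<in> linked r" "(a, y) \<in> linked r"
    by blast
  then show ?L
  proof cases
    case 1
    then show ?thesis
      by (rule mono)
  next
    case 2
    show ?thesis
      by (rule linked_trans[OF linked_trans[OF mono[OF 2(1)] ab] mono[OF 2(2)]])
  next
    case 3
    show ?thesis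
      by (rule linked_trans[OF linked_trans[OF mono[OF 3(1)] linked_sym[OF ab]] mono[OF 3(2)]])
  qed
qed

lemma num_classes_insert_linked:
  assumes "(a, b) \<in> linked r"
  shows "num_classes X (insert (a, b) r) = num_classes X r"
proof (rule num_classes_cong, rule antisym)
  show "linked (insert (a, b) r) \<subseteq> linked r"
    by (rule linked_mono) (use assms in \<open>auto intro: linkedI\<close>)
  show "linked r \<subseteq> linked (insert (a, b) r)"
    by (rule linked_mono) (auto intro: linkedI)
qed

lemma num_classes_insert_unlinked:
  assumes "finite X" "a \<in> X" "b \<in> X" "(a, b) \<notin> linked r"
  shows "Suc (num_classes X (insert (a, b) r)) = num_classes X r"
proof -
  let ?R = "linked r" and ?R' = "linked (insert (a, b) r)"
  let ?A = "?R `` {a}" and ?B = "?R `` {b}"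
  have cls: "?R' `` {x} = (if x \<in> ?A \<union> ?B then ?A \<union> ?B else ?R `` {x})" for x
  proof -
    have iff: "(p, z) \<in> ?R \<longleftrightarrow> (q, z) \<in> ?R" if "(p, q) \<in> ?R" for p q z
      using linked_trans[OF that] linked_trans[OF linked_sym[OF that]] by blast
    have flip: "(p, q) \<in> ?R \<longleftrightarrow> (q, p) \<in> ?R" for p q
      using linked_sym[of p q r] linked_sym[of q p r] by blast
    show ?thesis
    proof (rule set_eqI)
      fix y
      show "y \<in> ?R' `` {x} \<longleftrightarrow> y \<in> (if x \<in> ?A \<union> ?B then ?A \<union> ?B else ?R `` {x})"
        unfolding Image_singleton_iff linked_insert if_split_mem2 Un_iff
        using iff[of a x y] iff[of b x y] flip[of x a] flip[of x b] by argo
    qed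
  qed
  have AB: "?A \<noteq> ?B"
    using assms(4) by (simp add: linked_Image_eq del: Image_singleton_iff)
  have mem: "?A \<in> X // ?R" "?B \<in> X // ?R"
    using assms(2,3) by (auto intro: quotientI)
  have union: "C \<noteq> ?A \<union> ?B" if "C \<in> X // ?R" for C
  proof
    assume C: "C = ?A \<union> ?B"
    from that obtain x where x: "C = ?R `` {x}"
      by (auto simp: quotient_def)
    have "a \<in> C" "b \<in> C"
      using C by auto
    then have "(x, a) \<in> ?R" "(x, b) \<in> ?R"
      using x by auto
    then show False
      using assms(4) linked_trans[OF linked_sym[of x a] , of r b] by blast
  qed
  have other: "?R `` {x} \<noteq> ?A \<and> ?R `` {x} \<noteq> ?B" if "x \<notin> ?A \<union> ?B" for x
    using that linked_sym[of x _ r] unfolding linked_Image_eq by blast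
  have inAB: "?R `` {x} = ?A \<or> ?R `` {x} = ?B" if "x \<in> ?A \<union> ?B" for x
    using that linked_sym[of _ x r] unfolding linked_Image_eq by blast
  have "X // ?R' = insert (?A \<union> ?B) (X // ?R - {?A, ?B})" (is "?L = ?M")
  proof
    show "?L \<subseteq> ?M"
    proof
      fix C assume "C \<in> ?L"
      then obtain x where x: "x \<in> X" "C = ?R' `` {x}"
        by (auto simp: quotient_def)
      show "C \<in> ?M"
        using x other[of x] quotientI[OF x(1), of ?R] unfolding cls by (cases "x \<in> ?A \<union> ?B") simp_all
    qed
    show "?M \<subseteq> ?L"
    proof
      fix C assume "C \<in> ?M"
      then consider "C = ?A \<union> ?B" | x where "x \<in> X" "C = ?R `` {x}" "C \<noteq> ?A" "C \<noteq> ?B"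
        by (auto simp: quotient_def)
      then show "C \<in> ?L"
      proof cases
        case 1
        then have "C = ?R' `` {a}"
          unfolding cls by simp
        then show ?thesis
          using assms(2) by (auto intro: quotientI)
      next
        case 2
        then have "C = ?R' `` {x}"
          unfolding cls using inAB by auto
        then show ?thesis
          using 2(1) by (auto intro: quotientI)
      qed
    qed
  qed
  moreover have fin: "finite (X // ?R)"
    using assms(1) by (auto simp: quotient_def)
  moreover have sub: "{?A, ?B} \<subseteq> X // ?R"
    using mem by blast
  have "card (X // ?R - {?A, ?B}) = card (X // ?R) - 2"
    using card_Diff_subset[OF _ sub] AB by simp
  moreover have "2 \<le> card (X // ?R)"
    using card_mono[OF fin sub] AB by simp
  moreover have "?A \<union> ?B \<notin> X // ?R - {?A, ?B}"
    using union by blast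
  ultimately show ?thesis
    unfolding num_classes_linked by (simp del: Image_singleton_iff)
qed

lemma num_classes_le_card:
  assumes "finite W" and "\<And>x. x \<in> X \<Longrightarrow> h x \<in> W"
    and "\<And>x y. x \<in> X \<Longrightarrow> y \<in> X \<Longrightarrow> h x = h y \<Longrightarrow> (x, y) \<in> linked r"
  shows "num_classes X r \<le> card W"
proof -
  let ?pick = "\<lambda>w. linked r `` {SOME x. x \<in> X \<and> h x = w}"
  have "X // linked r \<subseteq> ?pick ` W"
  proof
    fix C assume "C \<in> X // linked r"
    then obtain x where x: "x \<in> X" "C = linked r `` {x}"
      by (auto simp: quotient_def)
    define y where "y = (SOME y. y \<in> X \<and> h y = h x)"
    have "y \<in> X \<and> h y = h x"
      unfolding y_def by (rule someI[of _ x]) (use x in simp)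
    then have "C = ?pick (h x)"
      using x assms(3) unfolding x(2) linked_Image_eq by (simp flip: y_def)
    then show "C \<in> ?pick ` W"
      using assms(2)[OF x(1)] by blast
  qed
  then show ?thesis
    unfolding num_classes_linked using assms(1)
    by (meson card_image_le card_mono finite_imageI le_trans)
qed

lemma num_classes_Un:
  assumes "finite X" "finite Y"
    and "\<And>x y. x \<in> X \<Longrightarrow> y \<in> Y \<Longrightarrow> (x, y) \<notin> linked r"
  shows "num_classes (X \<union> Y) r = num_classes X r + num_classes Y r"
proof -
  have "(X \<union> Y) // linked r = X // linked r \<union> Y // linked r"
    by (auto simp: quotient_def)
  moreover have "X // linked r \<inter> Y // linked r = {}"
    using assms(3) by (auto simp: quotient_def linked_Image_eq simp del: Image_singleton_iff)
  moreover have "finite (X // linked r)" "finite (Y // linked r)"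
    using assms(1,2) by (auto simp: quotient_def)
  ultimately show ?thesis
    by (simp add: num_classes_linked card_Un_disjoint)
qed

lemma num_classes_one:
  assumes "a \<in> X" "\<And>x. x \<in> X \<Longrightarrow> (a, x) \<in> linked r"
  shows "num_classes X r = 1"
proof -
  have "linked r `` {x} = linked r `` {a}" if "x \<in> X" for x
    using assms(2)[OF that] unfolding linked_Image_eq by (rule linked_sym)
  then have "(\<lambda>x. linked r `` {x}) ` X = {linked r `` {a}}"
    using assms(1) by blast
  then show ?thesis
    by (simp add: num_classes_linked quotient_def UNION_singleton_eq_range)
qed

text \<open>
  Adding the link \<open>(a, c)\<close> to the first relation and the link \<open>(a, b)\<close> to the second one
  produces the same classes, and a single link merges at most two classes. If \<open>a\<close> and \<open>b\<close> are linked
  anyway, only the first of these two links can merge anything.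
\<close>

lemma num_classes_rewire:
  fixes r :: "('a \<times> 'a) set"
  assumes "finite X" "a \<in> X" "b \<in> X" "c \<in> X" "d \<in> X"
  defines "before \<equiv> insert (a, b) (insert (c, d) r)"
    and "after \<equiv> insert (a, c) (insert (b, d) r)"
  shows "num_classes X before \<le> Suc (num_classes X after)"
    and "num_classes X after \<le> Suc (num_classes X before)"
    and "(a, b) \<in> linked r \<Longrightarrow> (a, c) \<notin> linked before \<Longrightarrow>
      num_classes X before = Suc (num_classes X after)"
proof -
  have all: "linked (insert (a, c) before) = linked (insert (a, b) after)"
  proof
    have "insert (a, c) before \<subseteq> linked (insert (a, b) after)" (is "_ \<subseteq> ?L")
    proof -
      have l: "(a, b) \<in> ?L" "(a, c) \<in> ?L" "(b, d) \<in> ?L"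
        by (auto intro!: linkedI simp: after_def)
      have "(c, d) \<in> ?L"
        by (rule linked_trans[OF linked_trans[OF linked_sym[OF l(2)] l(1)] l(3)])
      with l show ?thesis
        by (auto intro: linkedI simp: after_def before_def)
    qed
    then show "linked (insert (a, c) before) \<subseteq> linked (insert (a, b) after)"
      by (rule linked_mono)
    have "insert (a, b) after \<subseteq> linked (insert (a, c) before)" (is "_ \<subseteq> ?L")
    proof -
      have l: "(a, b) \<in> ?L" "(a, c) \<in> ?L" "(c, d) \<in> ?L"
        by (auto intro!: linkedI simp: before_def)
      have "(b, d) \<in> ?L"
        by (rule linked_trans[OF linked_trans[OF linked_sym[OF l(1)] l(2)] l(3)])
      with l show ?thesis
        by (auto intro: linkedI simp: after_def before_def)
    qed
    then show "linked (insert (a, b) after) \<subseteq> linked (insert (a, c) before)"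
      by (rule linked_mono)
  qed
  have 1: "num_classes X (insert (a, c) before) = num_classes X (insert (a, b) after)"
    by (rule num_classes_cong[OF all])
  note before = num_classes_insert_linked[of a c before X]
    num_classes_insert_unlinked[OF assms(1,2,4), of before]
  note after = num_classes_insert_linked[of a b after X]
    num_classes_insert_unlinked[OF assms(1,2,3), of after]
  show "num_classes X before \<le> Suc (num_classes X after)"
    using 1 before after by linarith
  show "num_classes X after \<le> Suc (num_classes X before)"
    using 1 before after by linarith
  assume "(a, b) \<in> linked r" and "(a, c) \<notin> linked before"
  moreover have "linked r \<subseteq> linked after"
    by (rule linked_mono) (auto simp: after_def intro: linkedI)
  ultimately show "num_classes X before = Suc (num_classes X after)"
    using 1 before(2) after(1) by auto
qed

lemma even_card_fixpoint_free_involution: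
  assumes "finite K" "\<And>x. x \<in> K \<Longrightarrow> h x \<in> K \<and> h x \<noteq> x \<and> h (h x) = x"
  shows "even (card K)"
  using assms
proof (induction "card K" arbitrary: K rule: less_induct)
  case less
  show ?case
  proof (cases "K = {}")
    case False
    then obtain x where x: "x \<in> K"
      by blast
    let ?L = "K - {x, h x}"
    have sub: "{x, h x} \<subseteq> K" "card {x, h x} = 2"
      using less.prems(2)[OF x] x by auto
    have "card ?L = card K - 2" "2 \<le> card K"
      using sub less.prems(1) by (metis card_Diff_subset finite_subset, metis card_mono)
    moreover have "even (card ?L)"
    proof (rule less.hyps)
      show "card ?L < card K"
        using calculation by simp
      show "finite ?L"
        using less.prems(1) by simp
      show "h y \<in> ?L \<and> h y \<noteq> y \<and> h (h y) = y" if "y \<in> ?L" for y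
        using that less.prems(2) x by (metis DiffD1 DiffD2 DiffI insert_iff singletonD)
    qed
    ultimately show ?thesis
      by simp
  qed simp
qed

text \<open>
  Sending each point to its partner is an involution without fixed points.
\<close>

lemma even_card_perfect_matching:
  assumes "finite K" and "\<And>x. x \<in> K \<Longrightarrow> \<exists>!y. (x, y) \<in> M \<or> (y, x) \<in> M"
    and "\<And>x y. x \<in> K \<Longrightarrow> (x, y) \<in> M \<or> (y, x) \<in> M \<Longrightarrow> y \<in> K \<and> y \<noteq> x"
  shows "even (card K)"
proof (rule even_card_fixpoint_free_involution[OF assms(1)])
  fix x assume x: "x \<in> K"
  define h where "h z = (THE y. (z, y) \<in> M \<or> (y, z) \<in> M)" for z
  have h: "(z, h z) \<in> M \<or> (h z, z) \<in> M" if "z \<in> K" for z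
    unfolding h_def by (rule theI'[OF assms(2)[OF that]])
  have hx: "h x \<in> K" "h x \<noteq> x"
    using assms(3)[OF x h[OF x]] by auto
  moreover have "h (h x) = x"
    using assms(2)[OF hx(1)] h[OF x] h[OF hx(1)] by blast
  ultimately show "h x \<in> K \<and> h x \<noteq> x \<and> h (h x) = x"
    by blast
qed

section \<open>Consecutive entries of cyclic lists\<close>

fun consec :: "'a list \<Rightarrow> ('a \<times> 'a) set" where
  "consec (a # b # xs) = insert (a, b) (consec (b # xs))"
| "consec _ = {}"

definition cyclic_consec :: "'a list \<Rightarrow> ('a \<times> 'a) set" where
  "cyclic_consec xs = set (zip xs (rotate1 xs))"

lemma consec_append:
  "xs \<noteq> [] \<Longrightarrow> ys \<noteq> [] \<Longrightarrow> consec (xs @ ys) = consec xs \<union> consec ys \<union> {(last xs, hd ys)}"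
proof (induction xs rule: consec.induct)
  case ("2_2" v)
  then show ?case by (cases ys) auto
qed auto

lemma cyclic_consec_conv: "xs \<noteq> [] \<Longrightarrow> cyclic_consec xs = consec (xs @ [hd xs])"
proof -
  have "set (zip (a # l) (l @ [z])) = consec ((a # l) @ [z])" for a z :: 'a and l
    by (induction l arbitrary: a) auto
  then show "xs \<noteq> [] \<Longrightarrow> ?thesis"
    unfolding cyclic_consec_def by (cases xs) auto
qed

lemma consec_concat:
  assumes "\<And>d. f d \<noteq> []"
  shows "consec (concat (map f xs)) =
    (\<Union>d\<in>set xs. consec (f d)) \<union> {(last (f d), hd (f d')) | d d'. (d, d') \<in> consec xs}"
proof (induction xs rule: consec.induct)
  case (1 a b xs)
  have "concat (map f (a # b # xs)) = f a @ concat (map f (b # xs))"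
    by simp
  then have "consec (concat (map f (a # b # xs))) =
      consec (f a) \<union> consec (concat (map f (b # xs))) \<union> {(last (f a), hd (f b))}"
    using assms by (simp add: consec_append)
  also have "\<dots> = (\<Union>d\<in>set (a # b # xs). consec (f d)) \<union>
      {(last (f d), hd (f d')) | d d'. (d, d') \<in> consec (a # b # xs)}"
    unfolding 1 by auto
  finally show ?case .
qed auto

text \<open>
  This describes the arcs of a disc with the list \<open>xs\<close> of ribbon ends when a bundle \<open>f d\<close> of parallel
  ends takes the place of each end \<open>d\<close>.
\<close>

lemma cyclic_consec_concat:
  assumes "\<And>d. f d \<noteq> []"
  shows "cyclic_consec (concat (map f xs)) =
    (\<Union>d\<in>set xs. consec (f d)) \<union> {(last (f d), hd (f d')) | d d'. (d, d') \<in> cyclic_consec xs}"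
proof (cases "xs = []")
  case False
  obtain x ys where x: "xs = x # ys"
    using False by (cases xs) auto
  obtain zs z where z: "xs = zs @ [z]"
    using False by (cases xs rule: rev_cases) auto
  have ne: "concat (map f xs) \<noteq> []" and hd: "hd (concat (map f xs)) = hd (f x)"
    using assms[of x] by (simp_all add: x)
  have last: "last (concat (map f xs)) = last (f z)"
    using assms[of z] by (simp add: z)
  have "cyclic_consec (concat (map f xs)) = consec (concat (map f xs)) \<union> {(last (f z), hd (f x))}"
    by (simp add: cyclic_consec_conv[OF ne] consec_append[OF ne] hd last)
  moreover have "cyclic_consec xs = consec xs \<union> {(z, x)}"
  proof -
    have "hd xs = x" "last xs = z"
      by (simp add: x) (simp add: z)
    then show ?thesis
      using consec_append[OF False, of "[x]"] by (simp add: cyclic_consec_conv[OF False])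
  qed
  ultimately show ?thesis
    unfolding consec_concat[of f, OF assms] by blast
qed (simp add: cyclic_consec_def)

lemma cyclic_consec_ex1:
  assumes "distinct xs" "d \<in> set xs"
  shows "\<exists>!d'. (d, d') \<in> cyclic_consec xs" "\<exists>!d'. (d', d) \<in> cyclic_consec xs"
proof -
  have uniq: "\<exists>!q. (p, q) \<in> set (zip ps qs)" if "distinct ps" "length ps = length qs" "p \<in> set ps"
    for p :: 'a and ps qs
  proof (rule ex_ex1I)
    show "\<exists>q. (p, q) \<in> set (zip ps qs)"
      using in_set_impl_in_set_zip1[OF that(2,3)] by blast
    show "q = q'" if "(p, q) \<in> set (zip ps qs)" "(p, q') \<in> set (zip ps qs)" for q q'
      using that \<open>distinct ps\<close> by (auto simp: set_zip nth_eq_iff_index_eq)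
  qed
  show "\<exists>!d'. (d, d') \<in> cyclic_consec xs"
    unfolding cyclic_consec_def by (rule uniq) (use assms in simp_all)
  have "(d', d) \<in> cyclic_consec xs \<longleftrightarrow> (d, d') \<in> set (zip (rotate1 xs) xs)" for d'
    unfolding cyclic_consec_def by (auto simp: set_zip)
  then show "\<exists>!d'. (d', d) \<in> cyclic_consec xs"
    using uniq[of "rotate1 xs" xs d] assms by simp
qed

lemma cyclic_consec_in_set: "(d, d') \<in> cyclic_consec xs \<Longrightarrow> d \<in> set xs \<and> d' \<in> set xs"
  unfolding cyclic_consec_def by (auto dest: set_zip_leftD set_zip_rightD)

section \<open>Boundary components of spanning ribbon subgraphs\<close>

lemma disc_arcs_conv:
  fixes G :: "('v, 'e) pre_ribbon_graph"
  shows "disc_arcs G = {((d, True), (d', False)) | d d' v. v \<in> verts G \<and> (d, d') \<in> cyclic_consec (rot G v)}"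
proof -
  have "(d, d') \<in> cyclic_consec xs \<longleftrightarrow>
      (\<exists>i<length xs. d = xs ! i \<and> d' = xs ! (Suc i mod length xs))" for d d' and xs :: "('e \<times> bool) list"
    unfolding cyclic_consec_def set_zip by (auto simp: nth_rotate1)
  then show ?thesis
    unfolding disc_arcs_def by (intro set_eqI) (simp only: mem_Collect_eq, blast)
qed

definition corners :: "('v, 'e) pre_ribbon_graph \<Rightarrow> (('e \<times> bool) \<times> bool) set" where
  "corners G = (edges G \<times> UNIV) \<times> UNIV"

text \<open>
  The two free sides of the ribbon \<open>x\<close>: the side starting at the second corner of one end leads to
  the second corner of the other end iff \<open>c\<close> holds, which is the case for a twisted ribbon.
\<close>

definition side_pair :: "'e \<Rightarrow> bool \<Rightarrow> ((('e \<times> bool) \<times> bool) \<times> (('e \<times> bool) \<times> bool)) set" where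
  "side_pair x c = {(((x, False), True), ((x, True), c)), (((x, False), False), ((x, True), \<not> c))}"

definition ribbon_links :: "'e set \<Rightarrow> 'e set \<Rightarrow> ((('e \<times> bool) \<times> bool) \<times> (('e \<times> bool) \<times> bool)) set" where
  "ribbon_links T S = (\<Union>x\<in>S. side_pair x (x \<in> T))"

text \<open>
  If a ribbon is deleted, the disc boundary runs on along the arc to which its end was attached.
\<close>

definition caps :: "'e set \<Rightarrow> ((('e \<times> bool) \<times> bool) \<times> (('e \<times> bool) \<times> bool)) set" where
  "caps S = {(((x, b), False), ((x, b), True)) | x b. x \<in> S}"

text \<open>
  The boundary of the spanning ribbon subgraph with the ribbons \<open>S\<close>. All spanning subgraphs live on
  the corners of \<open>G\<close>, so that their numbers of faces can be compared directly.
\<close>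

definition boundary_links ::
  "('v, 'e) pre_ribbon_graph \<Rightarrow> 'e set \<Rightarrow> ((('e \<times> bool) \<times> bool) \<times> (('e \<times> bool) \<times> bool)) set" where
  "boundary_links G S = disc_arcs G \<union> ribbon_links (twisted G) S \<union> caps (edges G - S)"

definition spanning_faces :: "('v, 'e) pre_ribbon_graph \<Rightarrow> 'e set \<Rightarrow> nat" where
  "spanning_faces G S =
     num_classes (corners G) (boundary_links G S) + card {v \<in> verts G. rot G v = []}"

lemma ribbon_sides_conv: "ribbon_sides G = ribbon_links (twisted G) (edges G)"
proof -
  have "{(((x, False), s), ((x, True), if x \<in> twisted G then s else \<not> s)) | s. s \<in> UNIV} =
      side_pair x (x \<in> twisted G)" for x
    by (auto simp: side_pair_def)
  moreover have "ribbon_sides G = (\<Union>x\<in>edges G.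
      {(((x, False), s), ((x, True), if x \<in> twisted G then s else \<not> s)) | s. s \<in> UNIV})"
    unfolding ribbon_sides_def by blast
  ultimately show ?thesis
    by (simp only: ribbon_links_def)
qed

lemma ribbon_links_remove: "e \<in> S \<Longrightarrow> ribbon_links T S = side_pair e (e \<in> T) \<union> ribbon_links T (S - {e})"
  unfolding ribbon_links_def by blast

lemma spanning_faces_edges: "spanning_faces G (edges G) = num_faces G"
  by (simp add: spanning_faces_def num_faces_def boundary_links_def ribbon_sides_conv corners_def
      caps_def)

lemma partial_petrial_sel [simp]:
  "verts (partial_petrial G A) = verts G"
  "edges (partial_petrial G A) = edges G"
  "rot (partial_petrial G A) = rot G"
  "twisted (partial_petrial G A) = (twisted G - A) \<union> (A - twisted G)"
  "disc_arcs (partial_petrial G A) = disc_arcs G"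
  "corners (partial_petrial G A) = corners G"
  "end_vertex (partial_petrial G A) = end_vertex G"
  by (simp_all add: partial_petrial_def disc_arcs_def corners_def end_vertex_def fun_eq_iff)

lemma add_parallel_sel [simp]:
  "verts (add_parallel G e xs) = verts G"
  "edges (add_parallel G e xs) = edges G \<union> set xs"
  "rot (add_parallel G e xs) v = concat (map (insert_parallel_ends G e xs) (rot G v))"
  "twisted (add_parallel G e xs) = (if e \<in> twisted G then twisted G \<union> set xs else twisted G)"
  by (simp_all add: add_parallel_def)

lemma insert_parallel_ends_nonempty [simp]: "insert_parallel_ends G e xs d \<noteq> []"
  by (simp add: insert_parallel_ends_def)

lemma empty_discs_add_parallel:
  "{v \<in> verts (add_parallel G e xs). rot (add_parallel G e xs) v = []} = {v \<in> verts G. rot G v = []}"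
proof -
  have "concat (map (insert_parallel_ends G e xs) ds) = [] \<longleftrightarrow> ds = []" for ds
    by (cases ds) auto
  then show ?thesis
    by (simp only: add_parallel_sel)
qed

text \<open>
  An arc of disc boundary that ended at a corner of \<open>e\<close> ends, once parallel ribbons have been
  inserted on this side of \<open>e\<close>, at the corresponding corner of the outermost of them.
\<close>

definition outer_corner where
  "outer_corner G e xs c =
     (if snd c then (last (insert_parallel_ends G e xs (fst c)), True)
      else (hd (insert_parallel_ends G e xs (fst c)), False))"

text \<open>
  The new ribbons follow \<open>e\<close> at its first end. At its second end they follow it if \<open>e\<close> is twisted and
  precede it otherwise, so the corner affected there is the second one iff \<open>e\<close> is twisted.
\<close>

lemma outer_corner_eq:
  "outer_corner G e xs ((y, b), s) =
     (if y = e \<and> xs \<noteq> [] \<and> s = (b \<longrightarrow> e \<in> twisted G) then ((last xs, b), s) else ((y, b), s))"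
  by (cases b; cases s; cases "xs = []")
    (auto simp: outer_corner_def insert_parallel_ends_def last_map hd_map hd_rev hd_append)

lemma disc_arcs_in_corners:
  assumes "(\<Union>v\<in>verts G. set (rot G v)) = edges G \<times> UNIV" "(a, b) \<in> disc_arcs G"
  shows "a \<in> corners G" "b \<in> corners G"
proof -
  obtain d d' v where "a = (d, True)" "b = (d', False)" "v \<in> verts G"
    "(d, d') \<in> cyclic_consec (rot G v)"
    using assms(2) by (auto simp: disc_arcs_conv)
  moreover from this have "d \<in> set (rot G v)" "d' \<in> set (rot G v)"
    unfolding cyclic_consec_def by (auto dest: set_zip_leftD set_zip_rightD)
  ultimately have "d \<in> edges G \<times> UNIV \<and> d' \<in> edges G \<times> UNIV"
    unfolding assms(1)[symmetric] by blast
  then show "a \<in> corners G" "b \<in> corners G"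
    using \<open>a = _\<close> \<open>b = _\<close> by (auto simp: corners_def)
qed

lemma disc_arcs_add_parallel:
  fixes G :: "('v, 'e) pre_ribbon_graph" and xs :: "'e list"
  assumes darts: "(\<Union>v\<in>verts G. set (rot G v)) = edges G \<times> UNIV" and "e \<in> edges G"
  defines "ends \<equiv> insert_parallel_ends G e xs"
  shows "disc_arcs (add_parallel G e xs) =
    (\<lambda>(a, b). (outer_corner G e xs a, outer_corner G e xs b)) ` disc_arcs G \<union>
    {((d, True), (d', False)) | d d'. (d, d') \<in> consec (ends (e, False)) \<union> consec (ends (e, True))}"
    (is "?L = ?M \<union> ?N")
proof -
  have inner: "consec (ends d) = {}" if "d \<noteq> (e, False)" "d \<noteq> (e, True)" for d
    using that by (simp add: ends_def insert_parallel_ends_def)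
  have ee: "\<exists>v\<in>verts G. (e, b) \<in> set (rot G v)" for b
    using assms(1,2) by blast
  have "?L = {((d, True), (d', False)) | d d' v. v \<in> verts G \<and>
    ((\<exists>c\<in>set (rot G v). (d, d') \<in> consec (ends c)) \<or>
     (\<exists>c c'. d = last (ends c) \<and> d' = hd (ends c') \<and> (c, c') \<in> cyclic_consec (rot G v)))}"
    unfolding disc_arcs_conv by (simp add: cyclic_consec_concat ends_def)
  also have "\<dots> = ?M \<union> ?N"
  proof (intro equalityI subsetI)
    fix p assume "p \<in> {((d, True), (d', False)) | d d' v. v \<in> verts G \<and>
      ((\<exists>c\<in>set (rot G v). (d, d') \<in> consec (ends c)) \<or>
       (\<exists>c c'. d = last (ends c) \<and> d' = hd (ends c') \<and> (c, c') \<in> cyclic_consec (rot G v)))}"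
    then consider d d' c where "p = ((d, True), (d', False))" "(d, d') \<in> consec (ends c)"
      | c c' v where "p = ((last (ends c), True), (hd (ends c'), False))" "v \<in> verts G"
        "(c, c') \<in> cyclic_consec (rot G v)"
      by blast
    then show "p \<in> ?M \<union> ?N"
    proof cases
      case 1
      then have "c = (e, False) \<or> c = (e, True)"
        using inner[of c] by blast
      then show ?thesis
        using 1 by blast
    next
      case 2
      then have "((c, True), (c', False)) \<in> disc_arcs G"
        unfolding disc_arcs_conv by blast
      then have "(outer_corner G e xs (c, True), outer_corner G e xs (c', False)) \<in> ?M"
        by (rule image_eqI[rotated]) simp
      then show ?thesis
        using 2(1) by (simp add: outer_corner_def ends_def)
    qed
  next
    fix p assume "p \<in> ?M \<union> ?N"
    then consider (M) "p \<in> ?M" | (N) "p \<in> ?N"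
      by blast
    then show "p \<in> {((d, True), (d', False)) | d d' v. v \<in> verts G \<and>
      ((\<exists>c\<in>set (rot G v). (d, d') \<in> consec (ends c)) \<or>
       (\<exists>c c'. d = last (ends c) \<and> d' = hd (ends c') \<and> (c, c') \<in> cyclic_consec (rot G v)))}"
    proof cases
      case M
      then obtain a b where "(a, b) \<in> disc_arcs G"
        and p: "p = (outer_corner G e xs a, outer_corner G e xs b)"
        by auto
      then obtain c c' v where c: "a = (c, True)" "b = (c', False)" "v \<in> verts G"
        "(c, c') \<in> cyclic_consec (rot G v)"
        unfolding disc_arcs_conv by blast
      then have "p = ((last (ends c), True), (hd (ends c'), False))"
        by (simp add: p outer_corner_def ends_def)
      with c show ?thesis
        by blast
    next
      case N
      then show ?thesis
        using ee by blast
    qed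
  qed
  finally show ?thesis .
qed

lemma twisted_petrial_add_parallel:
  assumes "twisted G \<subseteq> edges G" "A \<subseteq> edges G" "set xs \<inter> edges G = {}" "e \<in> edges G"
    and "A' = (if e \<in> A then A \<union> set xs else A)"
    and "x \<in> edges G \<union> set xs"
  shows "x \<in> twisted (partial_petrial (add_parallel G e xs) A') \<longleftrightarrow>
    (if x \<in> set xs then e else x) \<in> twisted (partial_petrial G A)"
  using assms by (cases "x \<in> set xs") auto

lemma ribbon_links_petrial_add_parallel:
  assumes "twisted G \<subseteq> edges G" "A \<subseteq> edges G" "set xs \<inter> edges G = {}" "e \<in> edges G"
    and "A' = (if e \<in> A then A \<union> set xs else A)"
  defines "T \<equiv> twisted (partial_petrial G A)"
  shows "ribbon_sides (partial_petrial (add_parallel G e xs) A') =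
    side_pair e (e \<in> T) \<union> ribbon_links T (edges G - {e}) \<union> (\<Union>x\<in>set xs. side_pair x (e \<in> T))"
proof -
  let ?H = "partial_petrial (add_parallel G e xs) A'"
  have tw: "x \<in> twisted ?H \<longleftrightarrow> (if x \<in> set xs then e else x) \<in> T" if "x \<in> edges G \<union> set xs" for x
    unfolding T_def by (rule twisted_petrial_add_parallel[OF assms(1-5) that])
  have "ribbon_sides ?H = (\<Union>x\<in>edges G. side_pair x (x \<in> twisted ?H)) \<union>
      (\<Union>x\<in>set xs. side_pair x (x \<in> twisted ?H))"
    unfolding ribbon_sides_conv ribbon_links_def partial_petrial_sel(2) add_parallel_sel(2) by blast
  also have "(\<Union>x\<in>edges G. side_pair x (x \<in> twisted ?H)) = (\<Union>x\<in>edges G. side_pair x (x \<in> T))"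
  proof (rule SUP_cong)
    fix x assume "x \<in> edges G"
    then show "side_pair x (x \<in> twisted ?H) = side_pair x (x \<in> T)"
      using tw[of x] assms(3) by auto
  qed simp
  also have "(\<Union>x\<in>set xs. side_pair x (x \<in> twisted ?H)) = (\<Union>x\<in>set xs. side_pair x (e \<in> T))"
    using tw by (intro SUP_cong) simp_all
  finally show ?thesis
    using assms(4) by (simp only: ribbon_links_remove[of e] flip: ribbon_links_def)
qed

section \<open>Faces after the addition of parallel ribbons\<close>

lemma num_faces_petrial:
  "num_faces (partial_petrial G A) =
     num_classes (corners G) (disc_arcs G \<union> ribbon_sides (partial_petrial G A)) +
     card {v \<in> verts G. rot G v = []}"
  by (simp add: num_faces_def corners_def)

text \<open>
  The facing sides of \<open>e\<close> and \<open>x\<close> bound a bigon of their own. On the remaining faces,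
  the other side of \<open>x\<close> takes over from the side of \<open>e\<close> that has become part of the bigon.
\<close>

lemma num_faces_add_parallel_untoggled:
  assumes darts: "(\<Union>v\<in>verts G. set (rot G v)) = edges G \<times> UNIV"
    and tw: "twisted G \<subseteq> edges G" and fin: "finite (edges G)"
    and e: "e \<in> edges G" and x: "x \<notin> edges G" and A: "A \<subseteq> edges G" "e \<notin> A"
  shows "num_faces (partial_petrial (add_parallel G e [x]) A) = Suc (num_faces (partial_petrial G A))"
proof -
  define t where "t = (e \<in> twisted G)"
  define T where "T = twisted (partial_petrial G A)"
  define R where "R = ribbon_links T (edges G - {e})"
  let ?H = "add_parallel G e [x]"
  let ?out = "outer_corner G e [x]"
  define r where "r = disc_arcs G \<union> ribbon_sides (partial_petrial G A)"
  define r' where "r' = disc_arcs ?H \<union> ribbon_sides (partial_petrial ?H A)"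
  have eT: "e \<in> T \<longleftrightarrow> t"
    using A by (simp add: T_def t_def)
  have xe: "x \<noteq> e"
    using e x by blast
  have r: "r = disc_arcs G \<union> side_pair e t \<union> R"
    using ribbon_links_remove[OF e, of T] eT
    by (simp add: r_def R_def ribbon_sides_conv Un_assoc flip: T_def del: partial_petrial_sel(4))
  have sides: "ribbon_sides (partial_petrial ?H A) = side_pair e t \<union> R \<union> side_pair x t"
    using ribbon_links_petrial_add_parallel[OF tw A(1), of "[x]" e A] e x A(2)
    by (simp add: R_def T_def t_def)
  have r': "r' = (\<lambda>(a, b). (?out a, ?out b)) ` disc_arcs G \<union>
      {(((e, False), True), ((x, False), False)),
       (if t then (((e, True), True), ((x, True), False)) else (((x, True), True), ((e, True), False)))} \<union>
      (side_pair e t \<union> R \<union> side_pair x t)"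
    unfolding r'_def sides disc_arcs_add_parallel[OF darts e]
    by (auto simp: insert_parallel_ends_def t_def)
  have out: "?out ((y, b), s) = (if y = e \<and> s = (b \<longrightarrow> t) then ((x, b), s) else ((y, b), s))" for y b s
    by (auto simp: outer_corner_eq t_def)
  define bigon where
    "bigon = {((e, False), True), ((x, False), False), ((e, True), t), ((x, True), \<not> t)}"
  \<comment> \<open>A left inverse of the map to outer corners. The bigon is a class of its own, so its image
    only has to be a single, arbitrary corner.\<close>
  define collapse where "collapse c = (if c = ((x, False), True) then ((e, False), True)
    else if c = ((x, True), t) then ((e, True), t)
    else if c \<in> bigon then ((e, False), False) else c)" for c
  have collapse_out: "collapse (?out c) = c" if "c \<in> corners G" for c
    using that x xe by (cases c; cases "fst c") (auto simp: out collapse_def bigon_def corners_def)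
  have out_bigon: "?out c \<notin> bigon" if "c \<in> corners G" for c
    using that x xe by (cases c; cases "fst c") (auto simp: out bigon_def corners_def)
  note arcs = disc_arcs_in_corners[OF darts]
  have R: "?out a = a \<and> ?out b = b \<and> collapse a = a \<and> collapse b = b \<and> a \<notin> bigon \<and> b \<notin> bigon"
    if abR: "(a, b) \<in> R" for a b
  proof -
    obtain z s s' where z: "z \<in> edges G" "z \<noteq> e" and ab: "a = ((z, False), s)" "b = ((z, True), s')"
      using abR unfolding R_def ribbon_links_def side_pair_def by blast
    moreover have "z \<noteq> x"
      using z x by blast
    ultimately show ?thesis
      by (simp add: out collapse_def bigon_def)
  qed
  have links: thesis if "(a, b) \<in> r'"
    and "\<And>a' b'. (a', b') \<in> disc_arcs G \<Longrightarrow> a = ?out a' \<Longrightarrow> b = ?out b' \<Longrightarrow> thesis"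
    and "a \<in> bigon \<Longrightarrow> b \<in> bigon \<Longrightarrow> thesis"
    and "(a, b) = (((e, False), False), ((e, True), \<not> t)) \<Longrightarrow> thesis"
    and "(a, b) = (((x, False), True), ((x, True), t)) \<Longrightarrow> thesis"
    and "(a, b) \<in> R \<Longrightarrow> thesis" for a b thesis
    using that(1) unfolding r'
  proof (elim UnE)
    assume "(a, b) \<in> (\<lambda>(a, b). (?out a, ?out b)) ` disc_arcs G"
    then show ?thesis
      using that(2) by auto
  next
    assume "(a, b) \<in> {(((e, False), True), ((x, False), False)),
      (if t then (((e, True), True), ((x, True), False)) else (((x, True), True), ((e, True), False)))}"
    then show ?thesis
      using that(3) by (cases t) (auto simp: bigon_def)
  next
    assume "(a, b) \<in> side_pair e t"
    then show ?thesis
      using that(3,4) unfolding side_pair_def bigon_def by blast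
  next
    assume "(a, b) \<in> side_pair x t"
    then show ?thesis
      using that(3,5) unfolding side_pair_def bigon_def by blast
  qed (rule that(6))
  have bigon_closed: "a \<in> bigon \<longleftrightarrow> b \<in> bigon" if "(a, b) \<in> linked r'" for a b
  proof (rule linked_closed[OF _ that])
    fix a b assume "(a, b) \<in> r'"
    then show "a \<in> bigon \<longleftrightarrow> b \<in> bigon"
    proof (rule links)
      show "a \<in> bigon \<longleftrightarrow> b \<in> bigon" if "(a', b') \<in> disc_arcs G" "a = ?out a'" "b = ?out b'" for a' b'
        using out_bigon arcs[OF that(1)] that(2,3) by blast
    qed (use R xe in \<open>auto simp: bigon_def\<close>)
  qed
  have "num_classes (corners ?H) r' = num_classes ((corners ?H - bigon) \<union> bigon) r'"
    using e by (intro arg_cong[where f = "\<lambda>X. num_classes X r'"]) (auto simp: corners_def bigon_def)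
  also have "\<dots> = num_classes (corners ?H - bigon) r' + num_classes bigon r'"
  proof (rule num_classes_Un)
    show "finite (corners ?H - bigon)"
      using fin by (simp add: corners_def)
    show "finite bigon"
      by (simp add: bigon_def)
    show "(a, b) \<notin> linked r'" if "a \<in> corners ?H - bigon" "b \<in> bigon" for a b
      using bigon_closed[of a b] that by blast
  qed
  also have "num_classes bigon r' = 1"
  proof (rule num_classes_one)
    show "((e, False), True) \<in> bigon"
      by (simp add: bigon_def)
    have steps: "(((e, False), True), ((x, False), False)) \<in> linked r'"
      "(((x, False), False), ((x, True), \<not> t)) \<in> linked r'"
      "(((e, False), True), ((e, True), t)) \<in> linked r'"
      using e by (auto intro!: linkedI simp: r' side_pair_def)
    show "(((e, False), True), c) \<in> linked r'" if "c \<in> bigon" for c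
      using that steps linked_trans[OF steps(1,2)] by (auto simp: bigon_def)
  qed
  also have "num_classes (corners ?H - bigon) r' = num_classes (corners G) r"
  proof (rule sym, rule num_classes_retract[where f = ?out and g = collapse])
    show "(?out a, ?out b) \<in> linked r'" if "(a, b) \<in> r" for a b
    proof (rule linkedI)
      from that consider "(a, b) \<in> disc_arcs G" | "(a, b) \<in> side_pair e t" | "(a, b) \<in> R"
        unfolding r by blast
      then show "(?out a, ?out b) \<in> r'"
      proof cases
        case 1
        then have "(?out a, ?out b) \<in> (\<lambda>(a, b). (?out a, ?out b)) ` disc_arcs G"
          by (rule image_eqI[rotated]) simp
        then show ?thesis
          unfolding r' by blast
      next
        case 2
        then show ?thesis
          unfolding r' by (auto simp: side_pair_def out)
      next
        case 3
        then show ?thesis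
          using R[OF 3] unfolding r' by simp
      qed
    qed
    show "(collapse a, collapse b) \<in> linked r" if "(a, b) \<in> r'" for a b
      using that
    proof (rule links)
      show "(collapse a, collapse b) \<in> linked r"
        if "(a', b') \<in> disc_arcs G" "a = ?out a'" "b = ?out b'" for a' b'
        using that arcs[OF that(1)] by (auto simp: collapse_out r intro: linkedI)
      show "(collapse a, collapse b) \<in> linked r" if "a \<in> bigon" "b \<in> bigon"
      proof -
        have "collapse c = ((e, False), False)" if "c \<in> bigon" for c
          using that xe by (auto simp: bigon_def collapse_def)
        then show ?thesis
          using that by simp
      qed
      show "(collapse a, collapse b) \<in> linked r" if "(a, b) \<in> R"
        using that R[OF that] by (auto simp: r intro: linkedI)
    qed (use xe in \<open>auto simp: collapse_def bigon_def r side_pair_def intro!: linkedI\<close>)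
    show "?out c \<in> corners ?H - bigon" if "c \<in> corners G" for c
      using out_bigon[OF that] that by (cases c; cases "fst c") (auto simp: out corners_def)
    show "collapse c \<in> corners G" if "c \<in> corners ?H - bigon" for c
      using that e by (cases c; cases "fst c"; cases t) (auto simp: collapse_def corners_def bigon_def)
    show "(collapse (?out c), c) \<in> linked r" if "c \<in> corners G" for c
      using collapse_out[OF that] by simp
    show "(?out (collapse c), c) \<in> linked r'" if "c \<in> corners ?H - bigon" for c
    proof -
      have "?out (collapse c) = c"
        using that by (cases c; cases "fst c"; cases t) (auto simp: collapse_def out bigon_def)
      then show ?thesis
        by simp
    qed
  qed
  finally show ?thesis
    unfolding num_faces_petrial r_def r'_def by (simp only: empty_discs_add_parallel)
qed

text \<open>
  Toggling turns the facing sides of consecutive ribbons into a path that crosses from ribbon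
  to ribbon. With \<open>e\<close>, \<open>x\<close> and \<open>y\<close> there are two such paths; each of them starts at an outer corner of
  \<open>e\<close> and ends at the outer corner of \<open>y\<close> in the position to which the corresponding side of \<open>e\<close> alone
  would lead. Contracting both paths therefore gives back the boundary of \<open>G\<close>.
\<close>

lemma num_faces_add_two_parallel_toggled:
  assumes darts: "(\<Union>v\<in>verts G. set (rot G v)) = edges G \<times> UNIV"
    and tw: "twisted G \<subseteq> edges G"
    and e: "e \<in> edges G" and x: "x \<notin> edges G" and y: "y \<notin> edges G" and xy: "x \<noteq> y"
    and A: "A \<subseteq> edges G" "e \<in> A"
  shows "num_faces (partial_petrial (add_parallel G e [x, y]) (A \<union> {x, y})) =
    num_faces (partial_petrial G A)"
proof -
  define t where "t = (e \<in> twisted G)"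
  define T where "T = twisted (partial_petrial G A)"
  define R where "R = ribbon_links T (edges G - {e})"
  let ?H = "add_parallel G e [x, y]"
  let ?out = "outer_corner G e [x, y]"
  define r where "r = disc_arcs G \<union> ribbon_sides (partial_petrial G A)"
  define r' where "r' = disc_arcs ?H \<union> ribbon_sides (partial_petrial ?H (A \<union> {x, y}))"
  have eT: "e \<in> T \<longleftrightarrow> \<not> t"
    using A by (simp add: T_def t_def)
  have xe: "x \<noteq> e" "y \<noteq> e"
    using e x y by blast+
  have r: "r = disc_arcs G \<union> side_pair e (\<not> t) \<union> R"
    using ribbon_links_remove[OF e, of T] eT
    by (simp add: r_def R_def ribbon_sides_conv Un_assoc flip: T_def del: partial_petrial_sel(4))
  have sides: "ribbon_sides (partial_petrial ?H (A \<union> {x, y})) =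
      side_pair e (\<not> t) \<union> R \<union> (side_pair x (\<not> t) \<union> side_pair y (\<not> t))"
    using ribbon_links_petrial_add_parallel[OF tw A(1), of "[x, y]" e "(A \<union> {x, y})"] e x y A(2)
    by (simp add: R_def T_def t_def Un_commute)
  have r': "r' = (\<lambda>(a, b). (?out a, ?out b)) ` disc_arcs G \<union>
      {(((e, False), True), ((x, False), False)), (((x, False), True), ((y, False), False))} \<union>
      (if t then {(((e, True), True), ((x, True), False)), (((x, True), True), ((y, True), False))}
       else {(((x, True), True), ((e, True), False)), (((y, True), True), ((x, True), False))}) \<union>
      (side_pair e (\<not> t) \<union> R \<union> (side_pair x (\<not> t) \<union> side_pair y (\<not> t)))"
    unfolding r'_def sides disc_arcs_add_parallel[OF darts e]
    by (auto simp: insert_parallel_ends_def t_def)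
  have out: "?out ((z, b), s) = (if z = e \<and> s = (b \<longrightarrow> t) then ((y, b), s) else ((z, b), s))" for z b s
    by (auto simp: outer_corner_eq t_def)
  \<comment> \<open>The inner corners of the path from the outer corner at the first end of \<open>e\<close>, and below those of
    the path from the outer corner at the second end.\<close>
  define path1 where
    "path1 = {((e, True), t), ((x, True), \<not> t), ((x, False), True), ((y, False), False)}"
  define path2 where
    "path2 = {((e, False), True), ((x, False), False), ((x, True), t), ((y, True), \<not> t)}"
  \<comment> \<open>A left inverse of the map to outer corners that contracts both paths to their starting points.\<close>
  define collapse where "collapse c = (if c = ((y, False), True) then ((e, False), True)
    else if c = ((y, True), t) then ((e, True), t)
    else if c \<in> path1 then ((e, False), False)
    else if c \<in> path2 then ((e, True), \<not> t) else c)" for c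
  have collapse_out: "collapse (?out c) = c" if "c \<in> corners G" for c
    using that x y xe by (cases c; cases "fst c") (auto simp: out collapse_def path1_def path2_def corners_def)
  have R: "?out a = a \<and> ?out b = b \<and> collapse a = a \<and> collapse b = b" if abR: "(a, b) \<in> R" for a b
  proof -
    obtain z s s' where z: "z \<in> edges G" "z \<noteq> e" and ab: "a = ((z, False), s)" "b = ((z, True), s')"
      using abR unfolding R_def ribbon_links_def side_pair_def by blast
    moreover have "z \<noteq> x" "z \<noteq> y"
      using z x y by blast+
    ultimately show ?thesis
      by (simp add: out collapse_def path1_def path2_def)
  qed
  note arcs = disc_arcs_in_corners[OF darts]
  have side: "(((z, False), True), ((z, True), \<not> t)) \<in> linked r'"
    "(((z, False), False), ((z, True), t)) \<in> linked r'" if "z = e \<or> z = x \<or> z = y" for z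
    by (rule linkedI, use that in \<open>auto simp: r' side_pair_def\<close>)+
  have arc_x: "(((e, False), True), ((x, False), False)) \<in> linked r'"
    by (rule linkedI) (simp add: r')
  have arc'_x: "(((e, True), t), ((x, True), \<not> t)) \<in> linked r'"
  proof (cases t)
    case True
    then show ?thesis
      by (intro linkedI) (simp add: r')
  next
    case False
    then show ?thesis
      by (intro linkedI') (simp add: r')
  qed
  have arc_y: "(((x, False), True), ((y, False), False)) \<in> linked r'"
    by (rule linkedI) (simp add: r')
  have arc'_y: "(((x, True), t), ((y, True), \<not> t)) \<in> linked r'"
  proof (cases t)
    case True
    then show ?thesis
      by (intro linkedI) (simp add: r')
  next
    case False
    then show ?thesis
      by (intro linkedI') (simp add: r')
  qed
  note steps1 = side(2)[of e, simplified] arc'_x linked_sym[OF side(1)[of x, simplified]] arc_y side(2)[of y, simplified]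
  note steps2 = linked_sym[OF side(1)[of e, simplified]] arc_x side(2)[of x, simplified] arc'_y linked_sym[OF side(1)[of y, simplified]]
  have path1: "(((e, False), False), c) \<in> linked r'" if "c \<in> insert ((y, True), t) path1" for c
    using that steps1 linked_trans[OF steps1(1,2)] linked_trans[OF linked_trans[OF steps1(1,2)] steps1(3)]
      linked_trans[OF linked_trans[OF linked_trans[OF steps1(1,2)] steps1(3)] steps1(4)]
      linked_trans[OF linked_trans[OF linked_trans[OF linked_trans[OF steps1(1,2)] steps1(3)] steps1(4)] steps1(5)]
    unfolding path1_def by blast
  have path2: "(((e, True), \<not> t), c) \<in> linked r'" if "c \<in> insert ((y, False), True) path2" for c
    using that steps2 linked_trans[OF steps2(1,2)] linked_trans[OF linked_trans[OF steps2(1,2)] steps2(3)]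
      linked_trans[OF linked_trans[OF linked_trans[OF steps2(1,2)] steps2(3)] steps2(4)]
      linked_trans[OF linked_trans[OF linked_trans[OF linked_trans[OF steps2(1,2)] steps2(3)] steps2(4)] steps2(5)]
    unfolding path2_def by blast
  have "num_classes (corners G) r = num_classes (corners ?H) r'"
  proof (rule num_classes_retract[where f = ?out and g = collapse])
    show "(?out a, ?out b) \<in> linked r'" if "(a, b) \<in> r" for a b
    proof -
      from that consider "(a, b) \<in> disc_arcs G" | "(a, b) = (((e, False), False), ((e, True), t))"
        | "(a, b) = (((e, False), True), ((e, True), \<not> t))" | "(a, b) \<in> R"
        unfolding r side_pair_def by auto
      then show ?thesis
      proof cases
        case 1
        then have "(?out a, ?out b) \<in> (\<lambda>(a, b). (?out a, ?out b)) ` disc_arcs G"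
          by (rule image_eqI[rotated]) simp
        then show ?thesis
          unfolding r' by (blast intro: linkedI)
      next
        case 2
        then show ?thesis
          using path1 by (simp add: out)
      next
        case 3
        then show ?thesis
          using linked_sym[OF path2[of "((y, False), True)"]] by (simp add: out)
      next
        case 4
        then show ?thesis
          using R[OF 4] unfolding r' by (simp add: linkedI)
      qed
    qed
    show "(collapse a, collapse b) \<in> linked r" if abr: "(a, b) \<in> r'" for a b
    proof -
      have ribbon: "(((e, False), False), ((e, True), t)) \<in> r" "(((e, False), True), ((e, True), \<not> t)) \<in> r"
        by (auto simp: r side_pair_def)
      have same: "collapse c = ((e, False), False)" if "c \<in> path1" for c
        using that xe xy by (auto simp: collapse_def path1_def)
      have same': "collapse c = ((e, True), \<not> t)" if "c \<in> path2" for c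
        using that xe xy by (auto simp: collapse_def path1_def path2_def)
      have start: "collapse ((e, False), False) = ((e, False), False)"
        "collapse ((e, True), \<not> t) = ((e, True), \<not> t)"
        using xe by (auto simp: collapse_def path1_def path2_def)
      from abr consider "(a, b) \<in> (\<lambda>(a, b). (?out a, ?out b)) ` disc_arcs G"
        | "{a, b} \<subseteq> insert ((e, False), False) path1"
        | "{a, b} \<subseteq> insert ((e, True), \<not> t) path2"
        | "(a, b) = (((y, False), False), ((y, True), t))"
        | "(a, b) = (((y, False), True), ((y, True), \<not> t))"
        | "(a, b) \<in> R"
        unfolding r'
      proof (elim UnE)
        assume "(a, b) \<in> side_pair e (\<not> t)"
        then show ?thesis
          using that(2,3) unfolding side_pair_def path1_def path2_def by auto
      next
        assume "(a, b) \<in> side_pair x (\<not> t)"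
        then show ?thesis
          using that(2-5) unfolding side_pair_def path1_def path2_def by auto
      next
        assume "(a, b) \<in> {(((e, False), True), ((x, False), False)), (((x, False), True), ((y, False), False))}"
        then show ?thesis
          using that(2,3) unfolding path1_def path2_def by auto
      next
        assume "(a, b) \<in> (if t then {(((e, True), True), ((x, True), False)), (((x, True), True), ((y, True), False))}
          else {(((x, True), True), ((e, True), False)), (((y, True), True), ((x, True), False))})"
        then show ?thesis
          using that(2,3) unfolding path1_def path2_def by (cases t) auto
      next
        assume "(a, b) \<in> side_pair y (\<not> t)"
        then show ?thesis
          using that(4,5) unfolding side_pair_def by auto
      qed (use that(1,6) in blast)+
      then show ?thesis
      proof cases
        case 1
        then obtain a' b' where "(a', b') \<in> disc_arcs G" "a = ?out a'" "b = ?out b'"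
          by auto
        then show ?thesis
          using arcs[of a' b'] by (auto simp: collapse_out r intro: linkedI)
      next
        case 2
        then have "collapse a = ((e, False), False)" "collapse b = ((e, False), False)"
          using same[of a] same[of b] start(1) by auto
        then show ?thesis
          by simp
      next
        case 3
        then have "collapse a = ((e, True), \<not> t)" "collapse b = ((e, True), \<not> t)"
          using same'[of a] same'[of b] start(2) by auto
        then show ?thesis
          by simp
      next
        case 4
        then show ?thesis
          using ribbon xe xy by (auto simp: collapse_def path1_def path2_def intro: linkedI)
      next
        case 5
        then show ?thesis
          using ribbon xe xy by (auto simp: collapse_def path1_def path2_def intro: linkedI)
      next
        case 6
        then show ?thesis
          using R[OF 6] by (simp add: r linkedI)
      qed
    qed
    show "?out c \<in> corners ?H" if "c \<in> corners G" for c
      using that by (cases c; cases "fst c") (auto simp: out corners_def)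
    show "collapse c \<in> corners G" if "c \<in> corners ?H" for c
      using that e by (cases c; cases "fst c"; cases t)
        (auto simp: collapse_def corners_def path1_def path2_def)
    show "(collapse (?out c), c) \<in> linked r" if "c \<in> corners G" for c
      using collapse_out[OF that] by simp
    show "(?out (collapse c), c) \<in> linked r'" if "c \<in> corners ?H" for c
    proof -
      consider "c \<in> path1" | "c \<in> path2" "c \<notin> path1" | "c \<notin> path1" "c \<notin> path2"
        by blast
      then show ?thesis
      proof cases
        case 1
        then have "?out (collapse c) = ((e, False), False)"
          using xe xy by (auto simp: collapse_def out path1_def)
        then show ?thesis
          using path1 1 by simp
      next
        case 2
        then have "?out (collapse c) = ((e, True), \<not> t)"
          using xe xy by (auto simp: collapse_def out path1_def path2_def)
        then show ?thesis
          using path2 2 by simp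
      next
        case 3
        consider "c = ((y, False), True)" | "c = ((y, True), t)"
          | "c \<noteq> ((y, False), True)" "c \<noteq> ((y, True), t)"
          by blast
        then have "?out (collapse c) = c"
        proof cases
          case 3
          obtain z b s where c: "c = ((z, b), s)"
            by (metis surj_pair)
          have "?out c = c"
            using \<open>c \<notin> path1\<close> \<open>c \<notin> path2\<close> unfolding c path1_def path2_def out by (cases b; cases s) auto
          moreover have "collapse c = c"
            using 3 \<open>c \<notin> path1\<close> \<open>c \<notin> path2\<close> by (simp add: collapse_def)
          ultimately show ?thesis
            by simp
        qed (simp_all add: collapse_def out)
        then show ?thesis
          by simp
      qed
    qed
  qed
  then show ?thesis
    unfolding num_faces_petrial r_def r'_def by (simp only: empty_discs_add_parallel)
qed

text \<open>
  With only two toggled ribbons, each of the paths returns to the disc at which it started and leaves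
  it at the outer corner of \<open>x\<close>. It thus passes the end of the bundle like the cap that replaces the end of \<open>e\<close>
  when \<open>e\<close> is deleted.
\<close>

lemma num_faces_add_parallel_toggled:
  assumes darts: "(\<Union>v\<in>verts G. set (rot G v)) = edges G \<times> UNIV"
    and tw: "twisted G \<subseteq> edges G"
    and e: "e \<in> edges G" and x: "x \<notin> edges G"
    and A: "A \<subseteq> edges G" "e \<in> A"
  shows "num_faces (partial_petrial (add_parallel G e [x]) (insert x A)) =
    spanning_faces (partial_petrial G A) (edges G - {e})"
proof -
  define t where "t = (e \<in> twisted G)"
  define T where "T = twisted (partial_petrial G A)"
  define R where "R = ribbon_links T (edges G - {e})"
  let ?H = "add_parallel G e [x]"
  let ?out = "outer_corner G e [x]"
  define r where "r = boundary_links (partial_petrial G A) (edges G - {e})"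
  define r' where "r' = disc_arcs ?H \<union> ribbon_sides (partial_petrial ?H (insert x A))"
  have eT: "e \<in> T \<longleftrightarrow> \<not> t"
    using A by (simp add: T_def t_def)
  have xe: "x \<noteq> e"
    using e x by blast
  have r: "r = disc_arcs G \<union> R \<union> caps {e}"
    using e by (simp add: r_def R_def boundary_links_def T_def double_diff)
  have sides: "ribbon_sides (partial_petrial ?H (insert x A)) =
      side_pair e (\<not> t) \<union> R \<union> (side_pair x (\<not> t))"
    using ribbon_links_petrial_add_parallel[OF tw A(1), of "[x]" e "(insert x A)"] e x  A(2)
    by (simp add: R_def T_def t_def Un_commute)
  have r': "r' = (\<lambda>(a, b). (?out a, ?out b)) ` disc_arcs G \<union>
      {(((e, False), True), ((x, False), False)),
       (if t then (((e, True), True), ((x, True), False)) else (((x, True), True), ((e, True), False)))} \<union>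
      (side_pair e (\<not> t) \<union> R \<union> (side_pair x (\<not> t)))"
    unfolding r'_def sides disc_arcs_add_parallel[OF darts e]
    by (auto simp: insert_parallel_ends_def t_def)
  have out: "?out ((z, b), s) = (if z = e \<and> s = (b \<longrightarrow> t) then ((x, b), s) else ((z, b), s))" for z b s
    by (auto simp: outer_corner_eq t_def)
  \<comment> \<open>The inner corners of both paths. The map \<open>collapse\<close> contracts them to the outer corners of \<open>e\<close> at
    which the paths start.\<close>
  define path1 where "path1 = {((e, True), t), ((x, True), \<not> t)}"
  define path2 where "path2 = {((e, False), True), ((x, False), False)}"
  define collapse where "collapse c = (if c = ((x, False), True) then ((e, False), True)
    else if c = ((x, True), t) then ((e, True), t)
    else if c \<in> path1 then ((e, False), False)
    else if c \<in> path2 then ((e, True), \<not> t) else c)" for c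
  have collapse_out: "collapse (?out c) = c" if "c \<in> corners G" for c
    using that x xe by (cases c; cases "fst c") (auto simp: out collapse_def path1_def path2_def corners_def)
  have R: "?out a = a \<and> ?out b = b \<and> collapse a = a \<and> collapse b = b" if abR: "(a, b) \<in> R" for a b
  proof -
    obtain z s s' where z: "z \<in> edges G" "z \<noteq> e" and ab: "a = ((z, False), s)" "b = ((z, True), s')"
      using abR unfolding R_def ribbon_links_def side_pair_def by blast
    moreover have "z \<noteq> x"
      using z x by blast
    ultimately show ?thesis
      by (simp add: out collapse_def path1_def path2_def)
  qed
  note arcs = disc_arcs_in_corners[OF darts]
  have side: "(((z, False), True), ((z, True), \<not> t)) \<in> linked r'"
    "(((z, False), False), ((z, True), t)) \<in> linked r'" if "z = e \<or> z = x" for z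
    by (rule linkedI, use that in \<open>auto simp: r' side_pair_def\<close>)+
  have arc_x: "(((e, False), True), ((x, False), False)) \<in> linked r'"
    by (rule linkedI) (simp add: r')
  have arc'_x: "(((e, True), t), ((x, True), \<not> t)) \<in> linked r'"
  proof (cases t)
    case True
    then show ?thesis
      by (intro linkedI) (simp add: r')
  next
    case False
    then show ?thesis
      by (intro linkedI') (simp add: r')
  qed
  note steps1 = side(2)[of e, simplified] arc'_x linked_sym[OF side(1)[of x, simplified]]
  note steps2 = linked_sym[OF side(1)[of e, simplified]] arc_x side(2)[of x, simplified]
  have path1: "(((e, False), False), c) \<in> linked r'" if "c \<in> insert ((x, False), True) path1" for c
    using that steps1 linked_trans[OF steps1(1,2)] linked_trans[OF linked_trans[OF steps1(1,2)] steps1(3)]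
    unfolding path1_def by blast
  have path2: "(((e, True), \<not> t), c) \<in> linked r'" if "c \<in> insert ((x, True), t) path2" for c
    using that steps2 linked_trans[OF steps2(1,2)] linked_trans[OF linked_trans[OF steps2(1,2)] steps2(3)]
    unfolding path2_def by blast
  have "num_classes (corners G) r = num_classes (corners ?H) r'"
  proof (rule num_classes_retract[where f = ?out and g = collapse])
    show "(?out a, ?out b) \<in> linked r'" if "(a, b) \<in> r" for a b
    proof -
      from that consider "(a, b) \<in> disc_arcs G" | "(a, b) = (((e, False), False), ((e, False), True))"
        | "(a, b) = (((e, True), False), ((e, True), True))" | "(a, b) \<in> R"
        unfolding r caps_def by auto
      then show ?thesis
      proof cases
        case 1
        then have "(?out a, ?out b) \<in> (\<lambda>(a, b). (?out a, ?out b)) ` disc_arcs G"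
          by (rule image_eqI[rotated]) simp
        then show ?thesis
          unfolding r' by (blast intro: linkedI)
      next
        case 2
        then show ?thesis
          using path1 by (simp add: out)
      next
        case 3
        then show ?thesis
          using path2[of "((x, True), t)"] linked_sym[OF path2[of "((x, True), t)"]]
          by (cases t) (simp_all add: out)
      next
        case 4
        then show ?thesis
          using R[OF 4] unfolding r' by (simp add: linkedI)
      qed
    qed
    show "(collapse a, collapse b) \<in> linked r" if abr: "(a, b) \<in> r'" for a b
    proof -
      have cap: "(((e, False), False), ((e, False), True)) \<in> linked r"
        "(((e, True), \<not> t), ((e, True), t)) \<in> linked r"
        by (cases t; auto simp: r caps_def intro: linkedI linkedI')+
      have same: "collapse c = ((e, False), False)" if "c \<in> path1" for c
        using that xe  by (auto simp: collapse_def path1_def)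
      have same': "collapse c = ((e, True), \<not> t)" if "c \<in> path2" for c
        using that xe  by (auto simp: collapse_def path1_def path2_def)
      have start: "collapse ((e, False), False) = ((e, False), False)"
        "collapse ((e, True), \<not> t) = ((e, True), \<not> t)"
        using xe by (auto simp: collapse_def path1_def path2_def)
      from abr consider "(a, b) \<in> (\<lambda>(a, b). (?out a, ?out b)) ` disc_arcs G"
        | "{a, b} \<subseteq> insert ((e, False), False) path1"
        | "{a, b} \<subseteq> insert ((e, True), \<not> t) path2"
        | "(a, b) = (((x, False), True), ((x, True), \<not> t))"
        | "(a, b) = (((x, False), False), ((x, True), t))"
        | "(a, b) \<in> R"
        unfolding r'
      proof (elim UnE)
        assume "(a, b) \<in> side_pair e (\<not> t)"
        then show ?thesis
          using that(2,3) unfolding side_pair_def path1_def path2_def by auto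
      next
        assume "(a, b) \<in> side_pair x (\<not> t)"
        then show ?thesis
          using that(2-5) unfolding side_pair_def path1_def path2_def by auto
      next
        assume "(a, b) \<in> {(((e, False), True), ((x, False), False)),
          (if t then (((e, True), True), ((x, True), False)) else (((x, True), True), ((e, True), False)))}"
        then show ?thesis
          using that(2,3) unfolding path1_def path2_def by (cases t) auto
      qed (use that(1,6) in blast)+
      then show ?thesis
      proof cases
        case 1
        then obtain a' b' where "(a', b') \<in> disc_arcs G" "a = ?out a'" "b = ?out b'"
          by auto
        then show ?thesis
          using arcs[of a' b'] by (auto simp: collapse_out r intro: linkedI)
      next
        case 2
        then have "collapse a = ((e, False), False)" "collapse b = ((e, False), False)"
          using same[of a] same[of b] start(1) by auto
        then show ?thesis
          by simp
      next
        case 3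
        then have "collapse a = ((e, True), \<not> t)" "collapse b = ((e, True), \<not> t)"
          using same'[of a] same'[of b] start(2) by auto
        then show ?thesis
          by simp
      next
        case 4
        then show ?thesis
          using cap linked_sym[OF cap(1)] linked_sym[OF cap(2)] xe by (auto simp: collapse_def path1_def path2_def)
      next
        case 5
        then show ?thesis
          using cap linked_sym[OF cap(1)] linked_sym[OF cap(2)] xe by (auto simp: collapse_def path1_def path2_def)
      next
        case 6
        then show ?thesis
          using R[OF 6] by (simp add: r linkedI)
      qed
    qed
    show "?out c \<in> corners ?H" if "c \<in> corners G" for c
      using that by (cases c; cases "fst c") (auto simp: out corners_def)
    show "collapse c \<in> corners G" if "c \<in> corners ?H" for c
      using that e by (cases c; cases "fst c"; cases t)
        (auto simp: collapse_def corners_def path1_def path2_def)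
    show "(collapse (?out c), c) \<in> linked r" if "c \<in> corners G" for c
      using collapse_out[OF that] by simp
    show "(?out (collapse c), c) \<in> linked r'" if "c \<in> corners ?H" for c
    proof -
      consider "c \<in> path1" | "c \<in> path2" "c \<notin> path1" | "c \<notin> path1" "c \<notin> path2"
        by blast
      then show ?thesis
      proof cases
        case 1
        then have "?out (collapse c) = ((e, False), False)"
          using xe by (auto simp: collapse_def out path1_def)
        then show ?thesis
          using path1 1 by simp
      next
        case 2
        then have "?out (collapse c) = ((e, True), \<not> t)"
          using xe by (auto simp: collapse_def out path1_def path2_def)
        then show ?thesis
          using path2 2 by simp
      next
        case 3
        have "?out (collapse c) = c"
          using 3 by (cases c; cases "fst c"; cases t) (auto simp: collapse_def out path1_def path2_def)
        then show ?thesis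
          by simp
      qed
    qed
  qed
  then show ?thesis
    unfolding num_faces_petrial spanning_faces_def r_def r'_def
    by (simp only: empty_discs_add_parallel partial_petrial_sel)
qed

section \<open>Deletion of ribbons and the sign of the Euler genus\<close>

context ribbon_graph
begin

lemma end_vertex_eq: "v \<in> verts G \<Longrightarrow> d \<in> set (rot G v) \<Longrightarrow> end_vertex G d = v"
  unfolding end_vertex_def using disjoint_rot by (intro the_equality) blast+

lemma end_vertex_disc:
  assumes "d \<in> edges G \<times> UNIV"
  shows "end_vertex G d \<in> verts G" "d \<in> set (rot G (end_vertex G d))"
proof -
  have "d \<in> (\<Union>v\<in>verts G. set (rot G v))"
    using assms unfolding Union_rot .
  then obtain v where "v \<in> verts G" "d \<in> set (rot G v)"
    by blast
  then show "end_vertex G d \<in> verts G" "d \<in> set (rot G (end_vertex G d))"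
    using end_vertex_eq[of v d] by auto
qed

lemma finite_corners: "finite (corners G)"
  by (simp add: corners_def finite_edges)

lemma disc_arcs_ex1:
  assumes "c \<in> corners G"
  shows "\<exists>!c'. (c, c') \<in> disc_arcs G \<or> (c', c) \<in> disc_arcs G"
proof -
  obtain d s where c: "c = (d, s)"
    by (cases c)
  obtain v where v: "v \<in> verts G" "d \<in> set (rot G v)"
    using assms end_vertex_disc[of d] by (simp add: c corners_def)
  have only: "w = v" if "w \<in> verts G" "d \<in> set (rot G w)" for w
    using disjoint_rot that v by blast
  note ex1 = cyclic_consec_ex1[OF distinct_rot[OF v(1)] v(2)]
  show ?thesis
  proof (cases s)
    case True
    then have c: "c = (d, True)"
      using c by simp
    obtain d' where d': "(d, d') \<in> cyclic_consec (rot G v)"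
      and unique: "\<And>d''. (d, d'') \<in> cyclic_consec (rot G v) \<Longrightarrow> d'' = d'"
      using ex1(1) by blast
    show ?thesis
    proof (rule ex1I[of _ "(d', False)"])
      show "(c, (d', False)) \<in> disc_arcs G \<or> ((d', False), c) \<in> disc_arcs G"
        unfolding disc_arcs_conv c using v(1) d' by blast
      show "c' = (d', False)" if link: "(c, c') \<in> disc_arcs G \<or> (c', c) \<in> disc_arcs G" for c'
      proof -
        obtain w d'' where w: "c' = (d'', False)" "w \<in> verts G" "(d, d'') \<in> cyclic_consec (rot G w)"
          using link unfolding disc_arcs_conv c by blast
        then have "w = v"
          using only[of w] cyclic_consec_in_set[OF w(3)] by blast
        then show ?thesis
          using w(1,3) unique by simp
      qed
    qed
  next
    case False
    then have c: "c = (d, False)"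
      using c by simp
    obtain d' where d': "(d', d) \<in> cyclic_consec (rot G v)"
      and unique: "\<And>d''. (d'', d) \<in> cyclic_consec (rot G v) \<Longrightarrow> d'' = d'"
      using ex1(2) by blast
    show ?thesis
    proof (rule ex1I[of _ "(d', True)"])
      show "(c, (d', True)) \<in> disc_arcs G \<or> ((d', True), c) \<in> disc_arcs G"
        unfolding disc_arcs_conv c using v(1) d' by blast
      show "c' = (d', True)" if link: "(c, c') \<in> disc_arcs G \<or> (c', c) \<in> disc_arcs G" for c'
      proof -
        obtain w d'' where w: "c' = (d'', True)" "w \<in> verts G" "(d'', d) \<in> cyclic_consec (rot G w)"
          using link unfolding disc_arcs_conv c by blast
        then have "w = v"
          using only[of w] cyclic_consec_in_set[OF w(3)] by blast
        then show ?thesis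
          using w(1,3) unique by simp
      qed
    qed
  qed
qed

text \<open>
  Parity argument: the disc arcs match all corners in pairs, whereas the sides of ribbons and
  the caps match all corners except the four corners of \<open>x\<close>. A class that contains exactly one of
  these four corners would have both even and odd cardinality.
\<close>

lemma cut_ribbon_end_linked:
  assumes S: "S \<subseteq> edges G" and x: "x \<in> edges G" "x \<notin> S"
  defines "r \<equiv> disc_arcs G \<union> ribbon_links (twisted G) S \<union> caps (edges G - S - {x})"
  assumes other: "\<And>s. (((x, False), False), ((x, True), s)) \<notin> linked r"
  shows "(((x, False), False), ((x, False), True)) \<in> linked r"
proof (rule ccontr)
  assume neg: "\<not> ?thesis"
  let ?a = "((x, False), False)"
  let ?M = "ribbon_links (twisted G) S \<union> caps (edges G - S - {x})"
  define K where "K = {c. (?a, c) \<in> linked r}"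
  have K_step: "c' \<in> K" if "c \<in> K" "(c, c') \<in> r \<or> (c', c) \<in> r" for c c'
  proof -
    have "(c, c') \<in> linked r"
      using that(2) linkedI[of c c' r] linkedI'[of c' c r] by blast
    then show ?thesis
      using that(1) linked_trans[of ?a c r c'] unfolding K_def by simp
  qed
  have in_corners: "p \<in> corners G \<longleftrightarrow> q \<in> corners G" if "(p, q) \<in> r" for p q
  proof -
    from that consider "(p, q) \<in> disc_arcs G"
      | y where "y \<in> edges G" "(p, q) \<in> side_pair y (y \<in> twisted G)" | "(p, q) \<in> caps (edges G)"
      using S unfolding r_def ribbon_links_def caps_def by blast
    then show ?thesis
    proof cases
      case 1
      then show ?thesis
        using disc_arcs_in_corners[OF Union_rot 1] by simp
    qed (auto simp: corners_def side_pair_def caps_def)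
  qed
  have K: "K \<subseteq> corners G"
  proof
    fix c assume "c \<in> K"
    then have "?a \<in> corners G \<longleftrightarrow> c \<in> corners G"
      by (intro linked_closed[of r, OF in_corners]) (simp_all add: K_def)
    then show "c \<in> corners G"
      using x(1) by (simp add: corners_def)
  qed
  then have fin: "finite K"
    using finite_corners finite_subset by blast
  have a: "?a \<in> K"
    by (simp add: K_def)
  have "even (card K)"
  proof (rule even_card_perfect_matching[OF fin])
    show "\<exists>!c'. (c, c') \<in> disc_arcs G \<or> (c', c) \<in> disc_arcs G" if "c \<in> K" for c
      using that K by (intro disc_arcs_ex1) blast
    show "c' \<in> K \<and> c' \<noteq> c" if "c \<in> K" "(c, c') \<in> disc_arcs G \<or> (c', c) \<in> disc_arcs G" for c c'
    proof
      show "c' \<in> K"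
        by (rule K_step[OF that(1)]) (use that(2) in \<open>auto simp: r_def\<close>)
      show "c' \<noteq> c"
        using that(2) by (auto simp: disc_arcs_conv)
    qed
  qed
  moreover have "even (card (K - {?a}))"
  proof (rule even_card_perfect_matching[where M = ?M])
    show "finite (K - {?a})"
      using fin by simp
    have K_edge: "\<exists>y b s. c = ((y, b), s) \<and> y \<in> edges G \<and> y \<noteq> x" if "c \<in> K - {?a}" for c
    proof -
      obtain y b s where c: "c = ((y, b), s)"
        by (metis surj_pair)
      have "y \<noteq> x"
        using that other neg unfolding c K_def by (cases b; cases s) auto
      moreover have "y \<in> edges G"
        using that K c by (auto simp: corners_def)
      ultimately show ?thesis
        using c by blast
    qed
    show "\<exists>!c'. (c, c') \<in> ?M \<or> (c', c) \<in> ?M" if cK: "c \<in> K - {?a}" for c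
    proof -
      obtain y b s where c: "c = ((y, b), s)" and y: "y \<in> edges G" "y \<noteq> x"
        using K_edge[OF cK] by blast
      show ?thesis
      proof (cases "y \<in> S")
        case True
        then have "(c, c') \<in> ?M \<or> (c', c) \<in> ?M \<longleftrightarrow>
            (c, c') \<in> side_pair y (y \<in> twisted G) \<or> (c', c) \<in> side_pair y (y \<in> twisted G)" for c'
          unfolding ribbon_links_def side_pair_def caps_def c by blast
        then show ?thesis
          unfolding c side_pair_def by (cases b; cases s; cases "y \<in> twisted G") auto
      next
        case False
        then have "(c, c') \<in> ?M \<or> (c', c) \<in> ?M \<longleftrightarrow> c' = ((y, b), \<not> s)" for c'
          unfolding ribbon_links_def side_pair_def caps_def c using y by (cases s) auto
        then show ?thesis
          by simp
      qed
    qed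
    show "c' \<in> K - {?a} \<and> c' \<noteq> c" if "c \<in> K - {?a}" "(c, c') \<in> ?M \<or> (c', c) \<in> ?M" for c c'
    proof -
      have "c' \<in> K"
        using K_step[of c c'] that by (auto simp: r_def)
      moreover have "c' \<noteq> ?a" "c' \<noteq> c"
        using that(2) x(2) by (auto simp: ribbon_links_def side_pair_def caps_def)
      ultimately show ?thesis
        by blast
    qed
  qed
  ultimately show False
    using card_Suc_Diff1[OF fin a] by (metis even_Suc)
qed

definition edge_links :: "'e set \<Rightarrow> ('v \<times> 'v) set" where
  "edge_links S = {(end_vertex G (x, False), end_vertex G (x, True)) | x. x \<in> S}"

text \<open>
  Every boundary link stays at a disc or runs along a ribbon of \<open>S\<close>, so a face cannot leave its component of
  the graph.
\<close>

lemma boundary_links_end_vertex: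
  assumes "S \<subseteq> edges G" "(a, b) \<in> linked (boundary_links G S)"
  shows "(end_vertex G (fst a), end_vertex G (fst b)) \<in> linked (edge_links S)"
proof (rule linked_map[OF _ assms(2)])
  fix p q assume "(p, q) \<in> boundary_links G S"
  then consider "(p, q) \<in> disc_arcs G" | y where "y \<in> S" "(p, q) \<in> side_pair y (y \<in> twisted G)"
    | "(p, q) \<in> caps (edges G - S)"
    unfolding boundary_links_def ribbon_links_def by blast
  then show "(end_vertex G (fst p), end_vertex G (fst q)) \<in> linked (edge_links S)"
  proof cases
    case 1
    then obtain d d' v where pq: "p = (d, True)" "q = (d', False)"
      and v: "v \<in> verts G" "(d, d') \<in> cyclic_consec (rot G v)"
      unfolding disc_arcs_conv by blast
    then have "end_vertex G d = v" "end_vertex G d' = v"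
      using cyclic_consec_in_set[OF v(2)] end_vertex_eq by blast+
    then show ?thesis
      by (simp add: pq)
  next
    case 2
    then have "(end_vertex G (fst p), end_vertex G (fst q)) \<in> edge_links S"
      unfolding edge_links_def side_pair_def by auto
    then show ?thesis
      by (rule linkedI)
  next
    case 3
    then show ?thesis
      by (auto simp: caps_def)
  qed
qed

text \<open>
  Inserting a ribbon replaces its two caps by its two sides, which is a rewiring of four
  corners. If the ribbon joins two components, the two faces at its ends are different and become one.
\<close>

lemma spanning_faces_insert:
  assumes S: "S \<subseteq> edges G" and x: "x \<in> edges G" "x \<notin> S"
  shows "spanning_faces G S \<le> Suc (spanning_faces G (insert x S))"
    and "spanning_faces G (insert x S) \<le> Suc (spanning_faces G S)"
    and "(end_vertex G (x, False), end_vertex G (x, True)) \<notin> linked (edge_links S) \<Longrightarrow>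
      spanning_faces G S = Suc (spanning_faces G (insert x S))"
proof -
  define r where "r = disc_arcs G \<union> ribbon_links (twisted G) S \<union> caps (edges G - S - {x})"
  let ?a = "((x, False), False)" and ?b = "((x, False), True)"
  \<comment> \<open>The corners to which the two sides of \<open>x\<close> lead from \<open>?a\<close> and from \<open>?b\<close>.\<close>
  define c where "c = ((x, True), x \<notin> twisted G)"
  define d where "d = ((x, True), x \<in> twisted G)"
  let ?before = "insert (?a, ?b) (insert (c, d) r)" and ?after = "insert (?a, c) (insert (?b, d) r)"
  have caps: "caps (edges G - S) =
      insert (?a, ?b) (insert (((x, True), False), ((x, True), True)) (caps (edges G - S - {x})))"
    using x by (auto simp: caps_def)
  have "boundary_links G S = insert (?a, ?b) (insert (((x, True), False), ((x, True), True)) r)"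
    unfolding boundary_links_def caps r_def by blast
  moreover have "linked \<dots> = linked ?before"
  proof
    have cd: "(((x, True), False), ((x, True), True)) \<in> linked ?before"
    proof (cases "x \<in> twisted G")
      case True
      then show ?thesis
        by (intro linkedI) (simp add: c_def d_def)
    next
      case False
      then show ?thesis
        by (intro linkedI') (simp add: c_def d_def)
    qed
    show "linked (insert (?a, ?b) (insert (((x, True), False), ((x, True), True)) r)) \<subseteq> linked ?before"
      by (rule linked_mono) (use cd in \<open>auto intro: linkedI\<close>)
    let ?cut = "insert (?a, ?b) (insert (((x, True), False), ((x, True), True)) r)"
    have dc: "(c, d) \<in> linked ?cut"
    proof (cases "x \<in> twisted G")
      case True
      then show ?thesis
        by (intro linkedI) (simp add: c_def d_def)
    next
      case False
      then show ?thesis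
        by (intro linkedI') (simp add: c_def d_def)
    qed
    show "linked ?before \<subseteq> linked ?cut"
      by (rule linked_mono) (use dc in \<open>auto intro: linkedI\<close>)
  qed
  ultimately have before: "linked (boundary_links G S) = linked ?before"
    by simp
  have "ribbon_links (twisted G) (insert x S) = {(?b, d), (?a, c)} \<union> ribbon_links (twisted G) S"
    by (simp add: ribbon_links_def side_pair_def c_def d_def)
  moreover have "edges G - insert x S = edges G - S - {x}"
    by blast
  ultimately have after: "boundary_links G (insert x S) = ?after"
    unfolding boundary_links_def r_def by (simp only:) blast
  note rewire = num_classes_rewire[OF finite_corners, of ?a ?b c d r]
  have mem: "?a \<in> corners G" "?b \<in> corners G" "c \<in> corners G" "d \<in> corners G"
    using x by (simp_all add: corners_def c_def d_def)
  note faces = spanning_faces_def[of G S, unfolded num_classes_cong[OF before]]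
    spanning_faces_def[of G "insert x S", unfolded after]
  show "spanning_faces G S \<le> Suc (spanning_faces G (insert x S))"
    "spanning_faces G (insert x S) \<le> Suc (spanning_faces G S)"
    unfolding faces using rewire(1,2)[OF mem] by simp_all
  assume ends: "(end_vertex G (x, False), end_vertex G (x, True)) \<notin> linked (edge_links S)"
  have unlinked: "(?a, ((x, True), s)) \<notin> linked (boundary_links G S)" for s
    using boundary_links_end_vertex[OF S, of ?a "((x, True), s)"] ends by auto
  have "linked r \<subseteq> linked (boundary_links G S)"
    unfolding before by (rule linked_mono) (auto intro: linkedI)
  then have "(?a, ?b) \<in> linked r"
    using unlinked cut_ribbon_end_linked[OF S x] unfolding r_def by blast
  moreover have "(?a, c) \<notin> linked ?before"
    using unlinked unfolding before c_def .
  ultimately show "spanning_faces G S = Suc (spanning_faces G (insert x S))"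
    unfolding faces using rewire(3)[OF mem] by simp
qed

lemma spanning_faces_empty: "spanning_faces G {} \<le> card (verts G)"
proof -
  let ?W = "{v \<in> verts G. rot G v \<noteq> []}"
  let ?r = "boundary_links G {}"
  have r: "?r = disc_arcs G \<union> caps (edges G)"
    by (simp add: boundary_links_def ribbon_links_def)
  have cap: "((d, False), (d, True)) \<in> linked ?r" if "d \<in> edges G \<times> UNIV" for d
    using that by (intro linkedI) (auto simp: r caps_def)
  have disc: "((rot G v ! 0, False), (rot G v ! i, False)) \<in> linked ?r"
    if "v \<in> verts G" "i < length (rot G v)" for v i
    using that(2)
  proof (induction i)
    case (Suc i)
    have "rot G v ! i \<in> edges G \<times> UNIV"
      using Union_rot that(1) Suc.prems by (metis UN_I Suc_lessD nth_mem)
    then have "((rot G v ! i, False), (rot G v ! i, True)) \<in> linked ?r"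
      by (rule cap)
    moreover have "((rot G v ! i, True), (rot G v ! Suc i, False)) \<in> linked ?r"
    proof (rule linkedI)
      have "((rot G v ! i, True), (rot G v ! (Suc i mod length (rot G v)), False)) \<in> disc_arcs G"
        unfolding disc_arcs_def using that(1) Suc_lessD[OF Suc.prems] by blast
      then show "((rot G v ! i, True), (rot G v ! Suc i, False)) \<in> ?r"
        using Suc.prems by (simp add: r)
    qed
    ultimately show ?case
      using linked_trans[OF linked_trans[OF Suc.IH]] Suc.prems by auto
  qed simp
  have first: "((rot G (end_vertex G (fst c)) ! 0, False), c) \<in> linked ?r" if "c \<in> corners G" for c
  proof -
    obtain d s where c: "c = (d, s)"
      by (cases c)
    have d: "d \<in> edges G \<times> UNIV"
      using that by (auto simp: c corners_def)
    then obtain v where v: "v \<in> verts G" "d \<in> set (rot G v)" "end_vertex G d = v"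
      using end_vertex_disc by blast
    then obtain i where "i < length (rot G v)" "d = rot G v ! i"
      by (metis in_set_conv_nth)
    then have "((rot G v ! 0, False), (d, False)) \<in> linked ?r"
      using disc[OF v(1)] by simp
    then show ?thesis
      using linked_trans[OF _ cap[OF d]] unfolding c by (cases s) (simp_all add: v(3))
  qed
  have "num_classes (corners G) ?r \<le> card ?W"
  proof (rule num_classes_le_card[where h = "\<lambda>c. end_vertex G (fst c)"])
    show "finite ?W"
      using finite_verts by simp
    show "end_vertex G (fst c) \<in> ?W" if "c \<in> corners G" for c
      using that end_vertex_disc[of "fst c"] by (auto simp: corners_def)
    show "(c, c') \<in> linked ?r"
      if "c \<in> corners G" "c' \<in> corners G" "end_vertex G (fst c) = end_vertex G (fst c')" for c c'
      by (rule linked_trans[OF linked_sym[OF first[OF that(1)]] first[OF that(2), folded that(3)]])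
  qed
  moreover have "verts G = ?W \<union> {v \<in> verts G. rot G v = []}"
    by blast
  then have "card (verts G) = card ?W + card {v \<in> verts G. rot G v = []}"
    using finite_verts card_Un_disjoint[of ?W "{v \<in> verts G. rot G v = []}"] by auto
  ultimately show ?thesis
    by (simp add: spanning_faces_def)
qed

text \<open>
  Inserting a ribbon adds at most one face. If it joins two components, it removes one face while
  the number of components drops by one, so the difference between the two sides of the inequality
  does not change.
\<close>

lemma spanning_faces_bound:
  assumes "S \<subseteq> edges G"
  shows "int (spanning_faces G S) \<le>
    2 * int (num_classes (verts G) (edge_links S)) - int (card (verts G)) + int (card S)"
proof -
  have "finite S"
    using assms finite_edges finite_subset by blast
  then show ?thesis
    using assms
  proof (induction S rule: finite_induct)
    case empty
    have "verts G // linked {} = (\<lambda>v. {v}) ` verts G"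
      by (auto simp: linked_def quotient_def)
    then have "num_classes (verts G) (edge_links {}) = card (verts G)"
      by (simp add: num_classes_linked edge_links_def card_image)
    then show ?case
      using spanning_faces_empty by simp
  next
    case (insert x S)
    then have S: "S \<subseteq> edges G" and x: "x \<in> edges G"
      by auto
    let ?u = "end_vertex G (x, False)" and ?w = "end_vertex G (x, True)"
    have uw: "?u \<in> verts G" "?w \<in> verts G"
      using x by (simp_all add: end_vertex_disc(1))
    have links: "edge_links (insert x S) = insert (?u, ?w) (edge_links S)"
      by (auto simp: edge_links_def)
    note IH = insert.IH[OF S]
    note faces = spanning_faces_insert[OF S x insert.hyps(2)]
    show ?case
    proof (cases "(?u, ?w) \<in> linked (edge_links S)")
      case True
      then show ?thesis
        using IH faces(2) insert.hyps num_classes_insert_linked[OF True, of "verts G"]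
        by (simp add: links)
    next
      case False
      then show ?thesis
        using IH faces(3)[OF False] insert.hyps
          num_classes_insert_unlinked[OF finite_verts uw False]
        by (simp add: links)
    qed
  qed
qed

lemma euler_genus_nonneg: "euler_genus G \<ge> 0"
proof -
  have "num_components G = num_classes (verts G) (edge_links (edges G))"
    by (simp add: num_components_def edge_links_def)
  then show ?thesis
    using spanning_faces_bound[of "edges G"] by (simp add: euler_genus_def spanning_faces_edges)
qed

lemma spanning_faces_delete_ribbon:
  assumes "e \<in> edges G"
  shows "\<bar>int (spanning_faces G (edges G - {e})) - int (num_faces G)\<bar> \<le> 1"
  using spanning_faces_insert(1,2)[of "edges G - {e}" e] assms
  by (simp add: insert_absorb flip: spanning_faces_edges)

end

section \<open>Bundles of parallel ribbons\<close>

lemma add_parallel_Nil: "add_parallel G e [] = G"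
proof -
  have "insert_parallel_ends G e [] = (\<lambda>d. [d])"
    by (auto simp: insert_parallel_ends_def)
  then show ?thesis
    by (simp add: add_parallel_def)
qed

text \<open>
  Bundles can be inserted in stages, always directly next to \<open>e\<close>, so it suffices to understand the insertion
  of one or two ribbons.
\<close>

lemma add_parallel_append:
  assumes "e \<notin> set xs"
  shows "add_parallel G e (ys @ xs) = add_parallel (add_parallel G e xs) e ys"
proof -
  let ?H = "add_parallel G e xs"
  have other: "concat (map (insert_parallel_ends ?H e ys) (map (\<lambda>x. (x, b)) zs)) = map (\<lambda>x. (x, b)) zs"
    if "e \<notin> set zs" for zs b
    using that by (induction zs) (auto simp: insert_parallel_ends_def)
  have "e \<in> twisted ?H \<longleftrightarrow> e \<in> twisted G"
    using assms by auto
  then have "concat (map (insert_parallel_ends ?H e ys) (insert_parallel_ends G e xs d)) =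
      insert_parallel_ends G e (ys @ xs) d" for d
    using other[of xs] other[of "rev xs"] assms
    by (auto simp: insert_parallel_ends_def[of G] simp del: map_map add_parallel_sel)
      (simp_all add: insert_parallel_ends_def del: add_parallel_sel)
  then have "concat (map (insert_parallel_ends G e (ys @ xs)) ds) =
      concat (map (insert_parallel_ends ?H e ys) (concat (map (insert_parallel_ends G e xs) ds)))" for ds
    by (induction ds) simp_all
  then show ?thesis
    using assms by (auto simp: add_parallel_def[of G e "ys @ xs"] add_parallel_def[of ?H])
qed

lemma in_rot_add_parallel:
  "(z, b) \<in> set (rot (add_parallel G e xs) v) \<longleftrightarrow>
     (z, b) \<in> set (rot G v) \<or> z \<in> set xs \<and> (e, b) \<in> set (rot G v)"
proof -
  have "(z, b) \<in> set (insert_parallel_ends G e xs d) \<longleftrightarrow> d = (z, b) \<or> z \<in> set xs \<and> d = (e, b)" for d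
    by (cases b) (auto simp: insert_parallel_ends_def)
  then show ?thesis
    by auto
qed

lemma darts_add_parallel:
  fixes G :: "('v, 'e) pre_ribbon_graph"
  assumes "(\<Union>v\<in>verts G. set (rot G v)) = edges G \<times> UNIV" "e \<in> edges G"
  shows "(\<Union>v\<in>verts (add_parallel G e xs). set (rot (add_parallel G e xs) v)) =
    edges (add_parallel G e xs) \<times> UNIV"
proof -
  have mem: "(\<exists>v\<in>verts G. (z, b) \<in> set (rot G v)) \<longleftrightarrow> z \<in> edges G" for z b
    using assms(1) by auto
  show ?thesis
  proof (rule set_eqI)
    fix d :: "'e \<times> bool"
    obtain z b where d: "d = (z, b)"
      by (cases d)
    have "d \<in> (\<Union>v\<in>verts (add_parallel G e xs). set (rot (add_parallel G e xs) v)) \<longleftrightarrow>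
        (\<exists>v\<in>verts G. (z, b) \<in> set (rot G v)) \<or> z \<in> set xs \<and> (\<exists>v\<in>verts G. (e, b) \<in> set (rot G v))"
      unfolding d UN_iff in_rot_add_parallel by auto
    then show "d \<in> (\<Union>v\<in>verts (add_parallel G e xs). set (rot (add_parallel G e xs) v)) \<longleftrightarrow>
        d \<in> edges (add_parallel G e xs) \<times> UNIV"
      unfolding mem using assms(2) by (simp add: d)
  qed
qed

context ribbon_graph
begin

lemma ribbon_graph_partial_petrial: "A \<subseteq> edges G \<Longrightarrow> ribbon_graph (partial_petrial G A)"
  using ribbon_graph_axioms by (auto simp: ribbon_graph_def)

lemma end_vertex_add_parallel:
  assumes "set xs \<inter> edges G = {}" "z \<in> edges G \<union> set xs"
  shows "end_vertex (add_parallel G e xs) (z, b) = end_vertex G (if z \<in> set xs then e else z, b)"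
proof -
  have "(z, b) \<notin> set (rot G v)" if "v \<in> verts G" "z \<in> set xs" for v
  proof -
    have "(z, b) \<notin> (\<Union>v\<in>verts G. set (rot G v))"
      unfolding Union_rot using that(2) assms(1) by auto
    then show ?thesis
      using that(1) by blast
  qed
  then have "v \<in> verts G \<and> (z, b) \<in> set (rot (add_parallel G e xs) v) \<longleftrightarrow>
      v \<in> verts G \<and> (if z \<in> set xs then e else z, b) \<in> set (rot G v)" for v
    unfolding in_rot_add_parallel by auto
  then show ?thesis
    unfolding end_vertex_def add_parallel_sel(1) by simp
qed

lemma num_faces_add_parallel_list_untoggled:
  assumes e: "e \<in> edges G" and A: "A \<subseteq> edges G" "e \<notin> A"
    and "distinct xs" "set xs \<inter> edges G = {}"
  shows "num_faces (partial_petrial (add_parallel G e xs) A) = num_faces (partial_petrial G A) + length xs"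
  using assms(4,5)
proof (induction xs)
  case Nil
  then show ?case
    by (simp add: add_parallel_Nil)
next
  case (Cons x xs)
  let ?H = "add_parallel G e xs"
  have "e \<notin> set xs"
    using e Cons.prems by auto
  then have "add_parallel G e (x # xs) = add_parallel ?H e [x]"
    using add_parallel_append[of e xs G "[x]"] by simp
  moreover have "num_faces (partial_petrial (add_parallel ?H e [x]) A) = Suc (num_faces (partial_petrial ?H A))"
  proof (rule num_faces_add_parallel_untoggled[OF darts_add_parallel[OF Union_rot e]])
    show "twisted ?H \<subseteq> edges ?H"
      using twisted_subset by auto
    show "finite (edges ?H)"
      using finite_edges by simp
  qed (use e A Cons.prems in auto)
  ultimately show ?case
    using Cons by simp
qed

text \<open>
  Pairs of ribbons next to \<open>e\<close> are removed until at most one ribbon is left.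
\<close>

lemma num_faces_add_parallel_list_toggled:
  assumes e: "e \<in> edges G" and A: "A \<subseteq> edges G" "e \<in> A"
    and "distinct xs" "set xs \<inter> edges G = {}"
  shows "num_faces (partial_petrial (add_parallel G e xs) (A \<union> set xs)) =
    (if even (length xs) then num_faces (partial_petrial G A)
     else spanning_faces (partial_petrial G A) (edges G - {e}))"
  using assms(4,5)
proof (induction xs rule: induct_list012)
  case 1
  then show ?case
    by (simp add: add_parallel_Nil)
next
  case (2 x)
  then show ?case
    using num_faces_add_parallel_toggled[OF Union_rot twisted_subset e _ A, of x] by simp
next
  case (3 x y xs)
  let ?H = "add_parallel G e xs"
  have "e \<notin> set xs"
    using e 3 by auto
  then have "add_parallel G e (x # y # xs) = add_parallel ?H e [x, y]"
    using add_parallel_append[of e xs G "[x, y]"] by simp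
  moreover have "num_faces (partial_petrial (add_parallel ?H e [x, y]) ((A \<union> set xs) \<union> {x, y})) =
      num_faces (partial_petrial ?H (A \<union> set xs))"
  proof (rule num_faces_add_two_parallel_toggled[OF darts_add_parallel[OF Union_rot e]])
    show "twisted ?H \<subseteq> edges ?H"
      using twisted_subset by auto
  qed (use e A "3.prems" in auto)
  moreover have "A \<union> set xs \<union> {x, y} = A \<union> set (x # y # xs)"
    by auto
  ultimately show ?case
    using 3 by simp
qed

end

section \<open>Exponents of the partial Petrial polynomial\<close>

lemma finite_orientable_sets: "finite (edges G) \<Longrightarrow> finite (orientable_sets G)"
  by (simp add: orientable_sets_def)

text \<open>
  All summands have the coefficient one, so nothing cancels.
\<close>

lemma poly_support_petrial_poly:
  assumes "finite (edges G)"
  shows "poly_support (petrial_poly G) = (\<lambda>A. nat (euler_genus (partial_petrial G A))) ` orientable_sets G"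
proof -
  let ?g = "\<lambda>A. nat (euler_genus (partial_petrial G A))"
  have "coeff (petrial_poly G) i = int (card {A \<in> orientable_sets G. ?g A = i})" for i
    using finite_orientable_sets[OF assms]
    by (simp add: petrial_poly_def coeff_sum sum.If_cases Int_def)
  moreover have "card {A \<in> orientable_sets G. ?g A = i} \<noteq> 0 \<longleftrightarrow> i \<in> ?g ` orientable_sets G" for i
    using finite_orientable_sets[OF assms] by (auto simp: card_eq_0_iff)
  ultimately show ?thesis
    by (auto simp: poly_support_def)
qed

text \<open>
  The correspondence between the sets of toggled ribbons before and after the addition of
  the ribbons \<open>xs\<close> parallel to \<open>e\<close>.
\<close>

definition with_parallels :: "'e \<Rightarrow> 'e list \<Rightarrow> 'e set \<Rightarrow> 'e set" where
  "with_parallels e xs A = (if e \<in> A then A \<union> set xs else A)"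

context ribbon_graph
begin

text \<open>
  The twists can be made to vanish on all ribbons, or made to form the cut around the disc
  at one end of \<open>e\<close>. As \<open>e\<close> is proper, exactly one of these two choices toggles \<open>e\<close>.
\<close>

lemma orientable_sets_nonempty:
  assumes "proper_ribbon G e"
  shows "\<exists>A\<in>orientable_sets G. e \<in> A" "\<exists>A\<in>orientable_sets G. e \<notin> A"
proof -
  have ori: "{x \<in> edges G. (x \<in> twisted G) = (flip (end_vertex G (x, False)) = flip (end_vertex G (x, True)))}
      \<in> orientable_sets G" for flip :: "'v \<Rightarrow> bool"
    unfolding orientable_sets_def orientable_def by (auto intro!: exI[of _ flip])
  let ?u = "end_vertex G (e, False)"
  have e: "e \<in> edges G" "end_vertex G (e, True) \<noteq> ?u"
    using assms by (auto simp: proper_ribbon_def)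
  note sets = ori[of "\<lambda>_. True"] ori[of "\<lambda>v. v = ?u"]
  show "\<exists>A\<in>orientable_sets G. e \<in> A"
  proof (cases "e \<in> twisted G")
    case True
    then show ?thesis
      by (intro bexI[OF _ sets(1)]) (use e in simp)
  next
    case False
    then show ?thesis
      by (intro bexI[OF _ sets(2)]) (use e in simp)
  qed
  show "\<exists>A\<in>orientable_sets G. e \<notin> A"
  proof (cases "e \<in> twisted G")
    case True
    then show ?thesis
      by (intro bexI[OF _ sets(2)]) (use e in simp)
  next
    case False
    then show ?thesis
      by (intro bexI[OF _ sets(1)]) (use e in simp)
  qed
qed

text \<open>
  The condition that an orientation of the discs is coherent along a parallel ribbon involves the same
  two discs and, up to toggling, the same twist as the condition for \<open>e\<close>. So the parallel ribbons must be
  toggled exactly if \<open>e\<close> is, and they then impose no further condition.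
\<close>

lemma orientable_sets_add_parallel:
  assumes e: "e \<in> edges G" and fresh: "set xs \<inter> edges G = {}"
  shows "orientable_sets (add_parallel G e xs) = with_parallels e xs ` orientable_sets G"
proof -
  let ?H = "add_parallel G e xs"
  have coherent: "(flip (end_vertex ?H (x, False)) = flip (end_vertex ?H (x, True))) =
        (x \<notin> twisted (partial_petrial ?H (with_parallels e xs A)))
      \<longleftrightarrow> (flip (end_vertex G (y, False)) = flip (end_vertex G (y, True))) =
        (y \<notin> twisted (partial_petrial G A))"
    if "A \<subseteq> edges G" "x \<in> edges G \<union> set xs" "y = (if x \<in> set xs then e else x)"
    for A x y and flip :: "'v \<Rightarrow> bool"
    using twisted_petrial_add_parallel[OF twisted_subset that(1) fresh e with_parallels_def that(2)]
      end_vertex_add_parallel[OF fresh that(2)] that(3) by simp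
  have orientable_lift: "orientable (partial_petrial ?H (with_parallels e xs A)) \<longleftrightarrow> orientable (partial_petrial G A)"
    if A: "A \<subseteq> edges G" for A
  proof -
    have "(\<forall>x\<in>edges G \<union> set xs. (flip (end_vertex ?H (x, False)) = flip (end_vertex ?H (x, True))) =
          (x \<notin> twisted (partial_petrial ?H (with_parallels e xs A)))) \<longleftrightarrow>
        (\<forall>y\<in>edges G. (flip (end_vertex G (y, False)) = flip (end_vertex G (y, True))) =
          (y \<notin> twisted (partial_petrial G A)))" (is "?L \<longleftrightarrow> ?R") for flip :: "'v \<Rightarrow> bool"
    proof
      assume L: ?L
      show ?R
      proof
        fix y assume y: "y \<in> edges G"
        then have "y \<notin> set xs"
          using fresh by blast
        then show "(flip (end_vertex G (y, False)) = flip (end_vertex G (y, True))) =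
            (y \<notin> twisted (partial_petrial G A))"
          using coherent[OF A, of y y flip] L y by simp
      qed
    next
      assume R: ?R
      show ?L
      proof
        fix x assume x: "x \<in> edges G \<union> set xs"
        then have "(if x \<in> set xs then e else x) \<in> edges G"
          using e by auto
        then show "(flip (end_vertex ?H (x, False)) = flip (end_vertex ?H (x, True))) =
            (x \<notin> twisted (partial_petrial ?H (with_parallels e xs A)))"
          unfolding coherent[OF A x refl] using R by blast
      qed
    qed
    then show ?thesis
      unfolding orientable_def partial_petrial_sel(2,7) add_parallel_sel(2) by (simp only:)
  qed
  have lift: "B = with_parallels e xs (B \<inter> edges G)"
    if B: "B \<subseteq> edges G \<union> set xs" "orientable (partial_petrial ?H B)" for B
  proof -
    obtain flip :: "'v \<Rightarrow> bool" where "\<forall>x\<in>edges G \<union> set xs.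
        (flip (end_vertex ?H (x, False)) = flip (end_vertex ?H (x, True))) =
        (x \<notin> twisted (partial_petrial ?H B))"
      using B(2) unfolding orientable_def partial_petrial_sel(2,7) add_parallel_sel(2) by (elim exE)
    then have flip: "(flip (end_vertex ?H (x, False)) = flip (end_vertex ?H (x, True))) =
        (x \<notin> twisted (partial_petrial ?H B))" if "x \<in> edges G \<union> set xs" for x
      using that by (rule bspec)
    have "x \<in> B \<longleftrightarrow> e \<in> B" if x: "x \<in> set xs" for x
    proof -
      have "end_vertex ?H (x, b) = end_vertex ?H (e, b)" for b
        using end_vertex_add_parallel[OF fresh, of x e b] end_vertex_add_parallel[OF fresh, of e e b] x e
        by auto
      then have "x \<in> twisted (partial_petrial ?H B) \<longleftrightarrow> e \<in> twisted (partial_petrial ?H B)"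
        using flip[of x] flip[of e] x e by auto
      moreover have "x \<notin> twisted G" "e \<notin> set xs" 
        using x e fresh twisted_subset by blast+
      ultimately show ?thesis
        using x by (auto split: if_splits)
    qed
    then show ?thesis
      using B(1) e fresh by (auto simp: with_parallels_def)
  qed
  show ?thesis
  proof (intro equalityI subsetI)
    fix B assume "B \<in> orientable_sets ?H"
    then have B: "B \<subseteq> edges G \<union> set xs" "orientable (partial_petrial ?H B)"
      by (auto simp: orientable_sets_def)
    then have "orientable (partial_petrial G (B \<inter> edges G))"
      using orientable_lift[of "B \<inter> edges G"] lift[OF B] by simp
    then show "B \<in> with_parallels e xs ` orientable_sets G"
      using lift[OF B] by (intro image_eqI[of _ _ "B \<inter> edges G"]) (auto simp: orientable_sets_def)
  next
    fix B assume "B \<in> with_parallels e xs ` orientable_sets G"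
    then obtain A where A: "A \<subseteq> edges G" "orientable (partial_petrial G A)" "B = with_parallels e xs A"
      by (auto simp: orientable_sets_def)
    moreover have "B \<subseteq> edges ?H"
      using A by (auto simp: with_parallels_def)
    ultimately show "B \<in> orientable_sets ?H"
      using orientable_lift by (auto simp: orientable_sets_def)
  qed
qed

lemma num_components_add_parallel:
  assumes "e \<in> edges G" "set xs \<inter> edges G = {}"
  shows "num_components (add_parallel G e xs) = num_components G"
proof -
  let ?H = "add_parallel G e xs"
  define h where "h x = (if x \<in> set xs then e else x)" for x
  have h: "h ` (edges G \<union> set xs) = edges G"
  proof
    show "h ` (edges G \<union> set xs) \<subseteq> edges G"
      using assms(1) by (auto simp: h_def)
    show "edges G \<subseteq> h ` (edges G \<union> set xs)"
    proof
      fix x assume x: "x \<in> edges G"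
      then have "h x = x"
        using assms(2) by (auto simp: h_def)
      then show "x \<in> h ` (edges G \<union> set xs)"
        using x by (metis UnI1 imageI)
    qed
  qed
  have "{(end_vertex ?H (x, False), end_vertex ?H (x, True)) | x. x \<in> edges ?H} =
      (\<lambda>x. (end_vertex G (h x, False), end_vertex G (h x, True))) ` (edges G \<union> set xs)"
    unfolding Setcompr_eq_image add_parallel_sel(2) Collect_mem_eq h_def
    by (intro image_cong refl) (simp only: end_vertex_add_parallel[OF assms(2), of _ e])
  also have "\<dots> = (\<lambda>x. (end_vertex G (x, False), end_vertex G (x, True))) ` h ` (edges G \<union> set xs)"
    by (simp only: image_image)
  finally have "{(end_vertex ?H (x, False), end_vertex ?H (x, True)) | x. x \<in> edges ?H} =
      {(end_vertex G (x, False), end_vertex G (x, True)) | x. x \<in> edges G}"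
    by (simp only: h Setcompr_eq_image Collect_mem_eq)
  then show ?thesis
    unfolding num_components_def by (simp only: add_parallel_sel(1))
qed

lemma euler_genus_partial_petrial:
  "euler_genus (partial_petrial G A) =
    2 * int (num_components G) - int (card (verts G)) + int (card (edges G)) -
    int (num_faces (partial_petrial G A))"
  by (simp add: euler_genus_def num_components_def)

lemma euler_genus_add_parallel:
  assumes "e \<in> edges G" "distinct xs" "set xs \<inter> edges G = {}"
  shows "euler_genus (partial_petrial (add_parallel G e xs) B) =
    2 * int (num_components G) - int (card (verts G)) + int (card (edges G)) + int (length xs) -
    int (num_faces (partial_petrial (add_parallel G e xs) B))"
proof -
  have "card (edges G \<union> set xs) = card (edges G) + length xs"
    using assms finite_edges by (simp add: card_Un_disjoint Int_commute distinct_card)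
  moreover have "num_components (partial_petrial (add_parallel G e xs) B) = num_components G"
    using num_components_add_parallel[OF assms(1,3)] by (simp add: num_components_def)
  ultimately show ?thesis
    by (simp add: euler_genus_def)
qed

lemma euler_genus_add_parallel_untoggled:
  assumes "e \<in> edges G" "distinct xs" "set xs \<inter> edges G = {}" "A \<subseteq> edges G" "e \<notin> A"
  shows "euler_genus (partial_petrial (add_parallel G e xs) A) = euler_genus (partial_petrial G A)"
  unfolding euler_genus_add_parallel[OF assms(1-3)] euler_genus_partial_petrial
  by (simp add: num_faces_add_parallel_list_untoggled[OF assms(1,4,5,2,3)])

lemma euler_genus_partial_petrial_nonneg:
  "A \<subseteq> edges G \<Longrightarrow> euler_genus (partial_petrial G A) \<ge> 0"
  by (rule ribbon_graph.euler_genus_nonneg[OF ribbon_graph_partial_petrial])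

lemma poly_support_add_parallel:
  assumes "e \<in> edges G" "set xs \<inter> edges G = {}"
  shows "poly_support (petrial_poly (add_parallel G e xs)) =
    (\<lambda>A. nat (euler_genus (partial_petrial (add_parallel G e xs) (with_parallels e xs A)))) ` orientable_sets G"
  using poly_support_petrial_poly[of "add_parallel G e xs"] finite_edges
  by (simp add: orientable_sets_add_parallel[OF assms] image_image)

text \<open>
  The number \<open>M + 2\<close> is missing between the exponents \<open>M\<close> and \<open>M + 4\<close> or more.
\<close>

lemma not_even_interpolating_add_parallel:
  fixes M :: int
  assumes e: "proper_ribbon G e" and xs: "distinct xs" "set xs \<inter> edges G = {}"
    and le: "\<And>A. A \<in> orientable_sets G \<Longrightarrow> e \<notin> A \<Longrightarrow> euler_genus (partial_petrial G A) \<le> M"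
    and eq: "B \<in> orientable_sets G" "e \<notin> B" "euler_genus (partial_petrial G B) = M"
    and ge: "\<And>A. A \<in> orientable_sets G \<Longrightarrow> e \<in> A \<Longrightarrow>
      M + 4 \<le> euler_genus (partial_petrial (add_parallel G e xs) (A \<union> set xs))"
  shows "\<not> even_interpolating (petrial_poly (add_parallel G e xs))"
proof
  let ?S = "poly_support (petrial_poly (add_parallel G e xs))"
  assume "even_interpolating (petrial_poly (add_parallel G e xs))"
  then obtain m m' :: int where S: "?S = {i. even i \<and> m \<le> int i \<and> int i \<le> m'}"
    unfolding even_interpolating_def by blast
  have e': "e \<in> edges G"
    using e by (simp add: proper_ribbon_def)
  note supp = poly_support_add_parallel[OF e' xs(2)]
  have untoggled: "euler_genus (partial_petrial (add_parallel G e xs) (with_parallels e xs A)) =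
      euler_genus (partial_petrial G A)" if "A \<in> orientable_sets G" "e \<notin> A" for A
    using that euler_genus_add_parallel_untoggled[OF e' xs] by (simp add: with_parallels_def orientable_sets_def)
  have M: "M \<ge> 0"
    using euler_genus_partial_petrial_nonneg[of B] eq by (simp add: orientable_sets_def)
  have "nat M \<in> ?S"
    unfolding supp using eq untoggled[OF eq(1,2)] by (intro image_eqI[OF _ eq(1)]) simp
  moreover obtain A0 where A0: "A0 \<in> orientable_sets G" "e \<in> A0"
    using orientable_sets_nonempty(1)[OF e] by blast
  have "nat (euler_genus (partial_petrial (add_parallel G e xs) (A0 \<union> set xs))) \<in> ?S"
    unfolding supp using A0 by (intro image_eqI[OF _ A0(1)]) (simp add: with_parallels_def)
  ultimately have "nat M + 2 \<in> ?S"
    using ge[OF A0] M unfolding S by auto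
  then obtain A where A: "A \<in> orientable_sets G"
    "nat M + 2 = nat (euler_genus (partial_petrial (add_parallel G e xs) (with_parallels e xs A)))"
    unfolding supp by blast
  show False
  proof (cases "e \<in> A")
    case True
    then show ?thesis
      using ge[OF A(1) True] A(2) M by (simp add: with_parallels_def)
  next
    case False
    then show ?thesis
      using le[OF A(1) False] untoggled[OF A(1) False] A(2) M by simp
  qed
qed

end

theorem theorem4p4:
  fixes G :: "('v, 'e) pre_ribbon_graph" and e :: 'e and es :: "nat \<Rightarrow> 'e" and n :: nat
  assumes "ribbon_graph G"
    and "proper_ribbon G e"
    and "inj_on es {1..max 1 n}"
    and "es ` {1..max 1 n} \<inter> edges G = {}"
  shows
    "(\<forall>A. card (poly_support (petrial_poly G)) = 1 \<longrightarrow>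
        A \<in> orientable_sets G \<and> e \<in> A \<longrightarrow>
        (int (f0_max (add_parallel G e [es 1]) e) = int (num_faces (partial_petrial G A)) + 1 \<and> n \<ge> 4 \<or>
         int (f0_max (add_parallel G e [es 1]) e) = int (num_faces (partial_petrial G A)) - 1 \<and> n \<ge> 3) \<longrightarrow>
        \<not> even_interpolating (petrial_poly (add_parallel G e (map es [1..<Suc n]))))
     \<and>
     (card (poly_support (petrial_poly G)) > 1 \<longrightarrow>
        int n \<ge> min (int (f0_max (add_parallel G e [es 1]) e) - int (f1_min G e) + 4)
                    (int (f0_max G e) - int (f1_min G e) + 4) \<longrightarrow>
        \<not> even_interpolating (petrial_poly (add_parallel G e (map es [1..<Suc n]))))"
proof -
  interpret ribbon_graph G
    by fact
  have e: "e \<in> edges G"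
    using assms(2) by (simp add: proper_ribbon_def)
  define xs where "xs = map es [1..<Suc n]"
  have set_xs: "set xs = es ` {1..n}"
    by (simp add: xs_def atLeastLessThanSuc_atLeastAtMost del: upt_Suc)
  have xs: "distinct xs" "set xs \<inter> edges G = {}" "length xs = n"
  proof -
    have "inj_on es {1..n}"
      by (rule inj_on_subset[OF assms(3)]) auto
    then show "distinct xs"
      unfolding xs_def distinct_map by (simp add: atLeastLessThanSuc_atLeastAtMost del: upt_Suc)
    show "set xs \<inter> edges G = {}"
    proof -
      have "es ` {1..n} \<subseteq> es ` {1..max 1 n}"
        by (intro image_mono) auto
      then show ?thesis
        using assms(4) unfolding set_xs by blast
    qed
    show "length xs = n"
      by (simp add: xs_def del: upt_Suc)
  qed
  have fresh1: "set [es 1] \<inter> edges G = {}"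
  proof -
    have "es 1 \<in> es ` {1..max 1 n}"
      by simp
    then have "es 1 \<notin> edges G"
      using assms(4) by blast
    then show ?thesis
      by simp
  qed
  define K where "K = 2 * int (num_components G) - int (card (verts G)) + int (card (edges G))"
  define f where "f A = int (num_faces (partial_petrial G A))" for A
  define d where "d A = int (spanning_faces (partial_petrial G A) (edges G - {e}))" for A
  define Q0 where "Q0 = {A \<in> orientable_sets G. e \<in> A}"
  define Q1 where "Q1 = {A \<in> orientable_sets G. e \<notin> A}"
  let ?H = "add_parallel G e xs"
  have edges: "A \<subseteq> edges G" if "A \<in> orientable_sets G" for A
    using that by (simp add: orientable_sets_def)
  have genus: "euler_genus (partial_petrial G A) = K - f A" for A
    by (simp add: euler_genus_partial_petrial K_def f_def)
  have genus_nonneg: "0 \<le> K - f A" if "A \<in> orientable_sets G" for A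
    using euler_genus_partial_petrial_nonneg[OF edges[OF that]] by (simp add: genus)
  have fd: "\<bar>d A - f A\<bar> \<le> 1" if "A \<in> orientable_sets G" for A
    using ribbon_graph.spanning_faces_delete_ribbon[OF ribbon_graph_partial_petrial[OF edges[OF that]], of e] e
    by (simp add: d_def f_def)
  have genus_H: "euler_genus (partial_petrial ?H (A \<union> set xs)) =
      (if even n then K - f A + int n else K - d A + int n)" if "A \<in> Q0" for A
    using that edges[of A] euler_genus_add_parallel[OF e xs(1,2)]
      num_faces_add_parallel_list_toggled[OF e _ _ xs(1,2), of A]
    by (simp add: Q0_def xs(3) K_def f_def d_def)
  have fin: "finite Q0" "finite Q1"
    using finite_orientable_sets[OF finite_edges] by (simp_all add: Q0_def Q1_def)
  have ne: "Q0 \<noteq> {}" "Q1 \<noteq> {}"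
    using orientable_sets_nonempty[OF assms(2)] by (auto simp: Q0_def Q1_def)
  have "{B \<in> orientable_sets (add_parallel G e [es 1]). e \<in> B} = (\<lambda>A. A \<union> {es 1}) ` Q0"
    unfolding orientable_sets_add_parallel[OF e fresh1] using e fresh1
    by (auto simp: with_parallels_def Q0_def)
  moreover have "num_faces (partial_petrial (add_parallel G e [es 1]) (A \<union> {es 1})) =
      spanning_faces (partial_petrial G A) (edges G - {e})" if "A \<in> Q0" for A
    using num_faces_add_parallel_list_toggled[OF e _ _ _ fresh1, of A] that edges[of A] by (simp add: Q0_def)
  ultimately have "f0_max (add_parallel G e [es 1]) e =
      Max ((\<lambda>A. spanning_faces (partial_petrial G A) (edges G - {e})) ` Q0)"
    unfolding f0_max_def by (simp add: image_image cong: image_cong)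
  then have "f0_max (add_parallel G e [es 1]) e
      \<in> (\<lambda>A. spanning_faces (partial_petrial G A) (edges G - {e})) ` Q0"
    and d_le: "\<And>A. A \<in> Q0 \<Longrightarrow> d A \<le> int (f0_max (add_parallel G e [es 1]) e)"
    using fin(1) ne(1) by (simp_all add: d_def)
  then obtain D where D: "D \<in> Q0" "d D = int (f0_max (add_parallel G e [es 1]) e)"
    by (auto simp: d_def)
  have "f0_max G e \<in> (\<lambda>A. num_faces (partial_petrial G A)) ` Q0"
    and f_le: "\<And>A. A \<in> Q0 \<Longrightarrow> f A \<le> int (f0_max G e)"
    using fin(1) ne(1) by (simp_all add: f0_max_def f_def flip: Q0_def)
  then obtain F where F: "F \<in> Q0" "f F = int (f0_max G e)"
    by (auto simp: f_def)
  have "f1_min G e \<in> (\<lambda>A. num_faces (partial_petrial G A)) ` Q1"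
    and f_ge: "\<And>A. A \<in> Q1 \<Longrightarrow> int (f1_min G e) \<le> f A"
    using fin(2) ne(2) by (simp_all add: f1_min_def f_def flip: Q1_def)
  then obtain F1 where F1: "F1 \<in> Q1" "f F1 = int (f1_min G e)"
    by (auto simp: f_def)
  \<comment> \<open>Fewest faces means largest genus among the sets that do not toggle \<open>e\<close>.\<close>
  note gap = not_even_interpolating_add_parallel[OF assms(2) xs(1,2), where B = F1 and M = "K - f F1"]
  have "\<not> even_interpolating (petrial_poly ?H)"
    if single: "card (poly_support (petrial_poly G)) = 1" and A: "A \<in> orientable_sets G" "e \<in> A"
      and n: "int (f0_max (add_parallel G e [es 1]) e) = int (num_faces (partial_petrial G A)) + 1 \<and> n \<ge> 4 \<or>
         int (f0_max (add_parallel G e [es 1]) e) = int (num_faces (partial_petrial G A)) - 1 \<and> n \<ge> 3"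
    for A
  proof -
    obtain g where "(\<lambda>B. nat (K - f B)) ` orientable_sets G = {g}"
      using single unfolding poly_support_petrial_poly[OF finite_edges] genus by (rule card_1_singletonE)
    then have const: "nat (K - f B) = g" if "B \<in> orientable_sets G" for B
      using that by blast
    have same: "f B = f A" if "B \<in> orientable_sets G" for B
      using const[OF that] const[OF A(1)] genus_nonneg[OF that] genus_nonneg[OF A(1)] by linarith
    have F1': "F1 \<in> orientable_sets G" "e \<notin> F1"
      using F1(1) by (auto simp: Q1_def)
    show ?thesis
    proof (rule gap)
      fix B assume B: "B \<in> orientable_sets G" "e \<in> B"
      then have "B \<in> Q0"
        by (simp add: Q0_def)
      \<comment> \<open>The genus grows by \<open>n\<close> if \<open>n\<close> is even. If \<open>n\<close> is odd, it grows by at least \<open>n - 1\<close> in the first case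
        and by at least \<open>n + 1\<close> in the second one. The values of \<open>n\<close> for which this would
        just miss four have the wrong parity.\<close>
      have "odd n \<longrightarrow> n \<noteq> 4" "even n \<longrightarrow> n \<noteq> 3"
        by auto
      then show "K - f F1 + 4 \<le> euler_genus (partial_petrial ?H (B \<union> set xs))"
        unfolding genus_H[OF \<open>B \<in> Q0\<close>] same[OF F1'(1)] same[OF B(1)]
        using n d_le[OF \<open>B \<in> Q0\<close>] by (auto simp flip: f_def)
    qed (use F1' same in \<open>auto simp: genus\<close>)
  qed
  moreover have "\<not> even_interpolating (petrial_poly ?H)"
    if n: "int n \<ge> min (int (f0_max (add_parallel G e [es 1]) e) - int (f1_min G e) + 4)
                    (int (f0_max G e) - int (f1_min G e) + 4)"
  proof
    assume even: "even_interpolating (petrial_poly ?H)"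
    have F1': "F1 \<in> orientable_sets G" "e \<notin> F1"
      using F1(1) by (auto simp: Q1_def)
    have in_supp: "even (nat (euler_genus (partial_petrial ?H (with_parallels e xs B))))" if "B \<in> orientable_sets G" for B
      using even that unfolding even_interpolating_def poly_support_add_parallel[OF e xs(2)] by auto
    have K1: "even (K - f F1)"
      using in_supp[OF F1'(1)] F1' euler_genus_add_parallel_untoggled[OF e xs(1,2) edges[OF F1'(1)]]
        genus_nonneg[OF F1'(1)] by (simp add: with_parallels_def genus even_nat_iff)
    have parity: "even (if even n then K - f B + int n else K - d B + int n)" if "B \<in> Q0" for B
    proof -
      have B: "B \<in> orientable_sets G" "e \<in> B"
        using that by (auto simp: Q0_def)
      have "0 \<le> (if even n then K - f B + int n else K - d B + int n)"
        using genus_nonneg[OF B(1)] fd[OF B(1)] odd_pos[of n] by auto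
      then show ?thesis
        using in_supp[OF B(1)] B(2) genus_H[OF that] by (simp add: with_parallels_def even_nat_iff)
    qed
    have near: "f F - 1 \<le> d D" "d D - 1 \<le> f F"
      using fd[of F] fd[of D] d_le[OF F(1)] f_le[OF D(1)] F D by (auto simp: Q0_def)
    \<comment> \<open>If \<open>n\<close> only satisfies the bound for the other parity, it falls short of its own bound by at
      most one, and by parity it cannot fall short by exactly one.\<close>
    have bound: "(if even n then f F else d D) - f F1 + 4 \<le> int n"
      using n near K1 parity[OF F(1)] parity[OF D(1)] unfolding F(2) D(2) F1(2)
      by (cases "even n") (simp_all, presburger+)
    have "\<not> even_interpolating (petrial_poly ?H)"
    proof (rule gap)
      fix B assume "B \<in> orientable_sets G" "e \<in> B"
      then have "B \<in> Q0"
        by (simp add: Q0_def)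
      then show "K - f F1 + 4 \<le> euler_genus (partial_petrial ?H (B \<union> set xs))"
        unfolding genus_H[OF \<open>B \<in> Q0\<close>]
        using bound f_le[of B] d_le[of B] F(2) D(2) by (auto split: if_splits)
    next
      show "euler_genus (partial_petrial G B) \<le> K - f F1" if "B \<in> orientable_sets G" "e \<notin> B" for B
        using f_ge[of B] that F1(2) by (simp add: genus Q1_def)
    qed (use F1' in \<open>auto simp: genus\<close>)
    then show False
      using even by blast
  qed
  ultimately show ?thesis
    unfolding xs_def by blast
qed

end
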